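(* Let $t,u$ be terms in the language $\{\cdot,\to,\wedge,\vee,1\}$ of Wajsberg hoops over $n$ variables. The following are equivalent: (1) $\mathsf{WH}\models (t\approx1)\Rightarrow(u\approx1)$; (2) $O_t\subseteq O_u$ (as subsets of $[0,1]^n$); (3) $\mathsf{MV}\models (t\approx1)\Rightarrow(u\approx1)$.
   Context: A Wajsberg hoop is an algebra $(A,\cdot,\to,1)$ with $(A,\cdot,1)$ a commutative monoid satisfying $x\to x=1$, $x\cdot(x\to y)=y\cdot(y\to x)$, $(x\cdot y)\to z=x\to(y\to z)$, and $(x\to y)\to y=(y\to x)\to x$. It is lattice-ordered by $x\le y$ iff $x\to y=1$, with $x\wedge y=x\cdot(x\to y)$ and $x\vee y=(x\to y)\to y$, and is regarded as an algebra in the signature $\{\cdot,\to,\wedge,\vee,1\}$. $\mathsf{WH}$ is the variety of Wajsberg hoops. $\mathsf{MV}$ is the variety of MV-algebras, presented (term-equivalently) as Wajsberg hoops with an additional constant $0$ that is the least element, in the signature $\{\cdot,\to,\wedge,\vee,0,1\}$. For a term $t$ over $n$ variables, $O_t=\{\mathbf x\in[0,1]^n: f_t(\mathbf x)=1\}$, where $f_t:[0,1]^n\to[0,1]$ is the term function of $t$ in the standard algebra on $[0,1]$ with $x\cdot y=\max\{0,x+y-1\}$, $x\to y=\min\{1,1-x+y\}$, $\wedge=\min$, $\vee=\max$ and constant $1$. A quasiequation $(t\approx1)\Rightarrow(u\approx1)$ is valid in a variety if in every algebra of the variety each assignment of the variables making $t$ equal to $1$ makes $u$ equal to $1$. *)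

theory Defs
  imports Complex_Main "HOL-Algebra.Group"
begin

datatype (vars: 'v) wh_term =
    Var 'v
  | One
  | Times "'v wh_term" "'v wh_term"
  | Imp "'v wh_term" "'v wh_term"
  | Meet "'v wh_term" "'v wh_term"
  | Join "'v wh_term" "'v wh_term"

record 'a hoop = "'a monoid" +
  himp :: "'a \<Rightarrow> 'a \<Rightarrow> 'a" (infixr \<open>\<leadsto>\<index>\<close> 65)
  hmeet :: "'a \<Rightarrow> 'a \<Rightarrow> 'a" (infixl \<open>\<curlywedge>\<index>\<close> 70)
  hjoin :: "'a \<Rightarrow> 'a \<Rightarrow> 'a" (infixl \<open>\<curlyvee>\<index>\<close> 70)

record 'a mv = "'a hoop" +
  hzero :: 'a (\<open>\<zero>\<index>\<close>)

locale wajsberg_hoop = comm_monoid A for A (structure) +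
  assumes imp_closed: "\<lbrakk>x \<in> carrier A; y \<in> carrier A\<rbrakk> \<Longrightarrow> x \<leadsto> y \<in> carrier A"
    and imp_refl: "x \<in> carrier A \<Longrightarrow> x \<leadsto> x = \<one>"
    and divisibility:
      "\<lbrakk>x \<in> carrier A; y \<in> carrier A\<rbrakk> \<Longrightarrow> x \<otimes> (x \<leadsto> y) = y \<otimes> (y \<leadsto> x)"
    and residuation:
      "\<lbrakk>x \<in> carrier A; y \<in> carrier A; z \<in> carrier A\<rbrakk>
        \<Longrightarrow> (x \<otimes> y) \<leadsto> z = x \<leadsto> (y \<leadsto> z)"
    and wajsberg:
      "\<lbrakk>x \<in> carrier A; y \<in> carrier A\<rbrakk> \<Longrightarrow> (x \<leadsto> y) \<leadsto> y = (y \<leadsto> x) \<leadsto> x"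
    and meet_eq: "\<lbrakk>x \<in> carrier A; y \<in> carrier A\<rbrakk> \<Longrightarrow> x \<curlywedge> y = x \<otimes> (x \<leadsto> y)"
    and join_eq: "\<lbrakk>x \<in> carrier A; y \<in> carrier A\<rbrakk> \<Longrightarrow> x \<curlyvee> y = (x \<leadsto> y) \<leadsto> y"

text \<open>The order of a Wajsberg hoop is given by \<open>x \<le> y\<close> iff \<open>x \<leadsto> y = \<one>\<close>, so
  \<open>zero_least\<close> says that \<open>\<zero>\<close> is the least element.\<close>

locale mv_algebra = wajsberg_hoop A for A (structure) +
  assumes zero_closed: "\<zero> \<in> carrier A"
    and zero_least: "x \<in> carrier A \<Longrightarrow> \<zero> \<leadsto> x = \<one>"

text \<open>The record scheme lets the same evaluation serve hoops and MV-algebras, where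
  the constant \<open>\<zero>\<close> is not used by the terms considered here.\<close>

primrec eval :: "('a, 'b) hoop_scheme \<Rightarrow> ('v \<Rightarrow> 'a) \<Rightarrow> 'v wh_term \<Rightarrow> 'a" where
  "eval A e (Var v) = e v"
| "eval A e One = \<one>\<^bsub>A\<^esub>"
| "eval A e (Times s t) = eval A e s \<otimes>\<^bsub>A\<^esub> eval A e t"
| "eval A e (Imp s t) = eval A e s \<leadsto>\<^bsub>A\<^esub> eval A e t"
| "eval A e (Meet s t) = eval A e s \<curlywedge>\<^bsub>A\<^esub> eval A e t"
| "eval A e (Join s t) = eval A e s \<curlyvee>\<^bsub>A\<^esub> eval A e t"

text \<open>A term over \<open>n\<close> variables is a \<open>t :: nat wh_term\<close> with \<open>vars t \<subseteq> {..<n}\<close>; an assignment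
  of its variables in \<open>A\<close> is an element of \<open>{..<n} \<rightarrow>\<^sub>E carrier A\<close>.\<close>

definition quasi_holds ::
    "('a, 'b) hoop_scheme \<Rightarrow> nat \<Rightarrow> nat wh_term \<Rightarrow> nat wh_term \<Rightarrow> bool" where
  "quasi_holds A n t u \<longleftrightarrow>
    (\<forall>e \<in> {..<n} \<rightarrow>\<^sub>E carrier A. eval A e t = \<one>\<^bsub>A\<^esub> \<longrightarrow> eval A e u = \<one>\<^bsub>A\<^esub>)"

text \<open>HOL cannot quantify over all types inside a formula, so validity in a variety takes
  as argument the type \<open>'a\<close> whose subsets serve as carriers. All algebras of cardinality at
  most that of \<open>'a\<close> occur up to isomorphism. A theorem polymorphic in an infinite type \<open>'a\<close>
  speaks about algebras of arbitrary size; a finite \<open>'a\<close> would only admit algebras of bounded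
  finite size.\<close>

definition WH_valid :: "'a itself \<Rightarrow> nat \<Rightarrow> nat wh_term \<Rightarrow> nat wh_term \<Rightarrow> bool" where
  "WH_valid T n t u \<longleftrightarrow> (\<forall>A :: 'a hoop. wajsberg_hoop A \<longrightarrow> quasi_holds A n t u)"

definition MV_valid :: "'a itself \<Rightarrow> nat \<Rightarrow> nat wh_term \<Rightarrow> nat wh_term \<Rightarrow> bool" where
  "MV_valid T n t u \<longleftrightarrow> (\<forall>A :: 'a mv. mv_algebra A \<longrightarrow> quasi_holds A n t u)"

definition standard_hoop :: "real hoop" where
  "standard_hoop =
    \<lparr>carrier = {0..1},
     monoid.mult = (\<lambda>x y. max 0 (x + y - 1)),
     one = 1,
     himp = (\<lambda>x y. min 1 (1 - x + y)),
     hmeet = min,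
     hjoin = max\<rparr>"

lemma wajsberg_hoop_standard: "wajsberg_hoop standard_hoop"
  by unfold_locales (auto simp: standard_hoop_def min_def max_def Units_def)

definition term_fun :: "nat wh_term \<Rightarrow> (nat \<Rightarrow> real) \<Rightarrow> real" where
  "term_fun t x = eval standard_hoop x t"

text \<open>The cube \<open>[0,1]\<^sup>n\<close> is represented as \<open>{..<n} \<rightarrow>\<^sub>E {0..1}\<close>.\<close>

definition one_set :: "nat \<Rightarrow> nat wh_term \<Rightarrow> (nat \<Rightarrow> real) set" where
  "one_set n t = {x \<in> {..<n} \<rightarrow>\<^sub>E {0..1}. term_fun t x = 1}"

end

theory Submission
  imports Defs "HOL-Library.Multiset" "HOL-Library.Countable_Set"
    "HOL-Library.Countable"
begin

text \<open>A hoop refutation of a quasiequation lives in an interval \<open>[m, 1]\<close> with \<open>m\<close> below the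
  values of all subterms, and such intervals are MV-algebras. A refutation in an MV-algebra
  survives in the quotient by a filter maximal among those missing \<open>u\<close>, which is a chain \<open>C\<close>.
  Over \<open>C\<close> one builds the line \<open>\<int> \<times> (C - {1})\<close>, on which \<open>C\<close> acts by commuting strictly
  monotone shifts (addition with carry); comparing the resulting sums gives a translation
  invariant total preorder on multisets over \<open>C\<close>. Fourier-Motzkin elimination realizes any
  finite part of this preorder by real numbers, and after normalization these embed the finitely
  many relevant elements of \<open>C\<close> into \<open>[0,1]\<close>. Conversely, a refutation in \<open>[0,1]\<close> lives in a
  countable subalgebra, which has a copy in every infinite type.\<close>

section \<open>Wajsberg hoops\<close>

text \<open>A hoop need not have a least element, and a product of two elements above
  \<open>m\<close> may drop below \<open>m\<close>. The interval therefore carries a truncated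
  product, and \<open>m\<close> is chosen so low that no truncation occurs while the two terms are
  evaluated. The line is the underlying set of Chang's totally ordered group with strong unit 1. No
  group is built: commuting shifts suffice to define sums over multisets, and the fact that shifts
  also reflect the order supplies the cancellation law that a group would give. Chang's group can
  fail to be archimedean, so a chain need not embed into [0,1] as a whole; this is why only finitely
  many comparisons are realized at a time. Comparisons of two-element sums are enough, because on a
  chain the operations are linear up to truncation: x \<rightarrow> y = 1 - x + y for y \<le> x, and
  x y = x + y - 1 or 0. Validity refers to algebras on a fixed type. Intervals stay in the type of
  the hoop, whereas a refutation over the reals has to be cut down before it can be moved.\<close>

context wajsberg_hoop
begin

abbreviation hle :: "'a \<Rightarrow> 'a \<Rightarrow> bool" (infix \<open>\<preceq>\<close> 50) where
  "x \<preceq> y \<equiv> x \<leadsto> y = \<one>"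

lemma exchange:
  assumes "x \<in> carrier A" "y \<in> carrier A" "z \<in> carrier A"
  shows "x \<leadsto> (y \<leadsto> z) = y \<leadsto> (x \<leadsto> z)"
  using assms residuation m_comm by metis

text \<open>The unit law has to be extracted from divisibility. For \<open>\<one>\<close> and
  \<open>x\<close> it gives \<open>\<one> \<leadsto> x = x \<otimes> ?b\<close>; for
  \<open>x\<close> and \<open>\<one> \<leadsto> x\<close>, and then for \<open>?b\<close> and
  \<open>\<one>\<close>, it rewrites \<open>x\<close> into the same product.\<close>

lemma one_imp:
  assumes x: "x \<in> carrier A"
  shows "\<one> \<leadsto> x = x"
proof -
  let ?b = "x \<leadsto> \<one>"
  have b: "?b \<in> carrier A" using x by (simp add: imp_closed)
  have fix1: "\<one> \<leadsto> (x \<leadsto> y) = x \<leadsto> y" if "y \<in> carrier A" for y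
    using residuation[of \<one> x y] x that by simp
  have a: "\<one> \<leadsto> x = x \<otimes> ?b"
    using divisibility[of \<one> x] x by (simp add: imp_closed)
  have "x \<leadsto> (\<one> \<leadsto> x) = \<one>"
    using exchange[of x \<one> x] x fix1 by (simp add: imp_refl)
  then have "x = (x \<otimes> ?b) \<otimes> ((x \<otimes> ?b) \<leadsto> x)"
    using divisibility[of x "\<one> \<leadsto> x"] x by (simp add: a imp_closed)
  also have "(x \<otimes> ?b) \<leadsto> x = ?b \<leadsto> \<one>"
    using x b residuation[of ?b x x] by (simp add: m_comm imp_refl)
  also have "(x \<otimes> ?b) \<otimes> (?b \<leadsto> \<one>) = x \<otimes> (\<one> \<leadsto> ?b)"
    using x b divisibility[of ?b \<one>] by (simp add: m_assoc imp_closed)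
  also have "\<dots> = \<one> \<leadsto> x" using a fix1 by simp
  finally show ?thesis by simp
qed

text \<open>The Wajsberg law makes \<open>(x \<leadsto> \<one>) \<leadsto> \<one>\<close> equal to
  \<open>x \<leadsto> x\<close>, hence to \<open>\<one>\<close>. Prefixing \<open>x\<close> and
  exchanging gives \<open>x \<leadsto> \<one>\<close> on one side and an instance of reflexivity on
  the other.\<close>

lemma imp_one:
  assumes x: "x \<in> carrier A"
  shows "x \<preceq> \<one>"
proof -
  have b: "x \<leadsto> \<one> \<in> carrier A" using x by (simp add: imp_closed)
  have "(x \<leadsto> \<one>) \<leadsto> \<one> = \<one>"
    using wajsberg[of x \<one>] x by (simp add: one_imp imp_refl)
  then show ?thesis
    using exchange[of x "x \<leadsto> \<one>" \<one>] x b by (simp add: imp_refl)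
qed

lemma hle_antisym:
  assumes "x \<in> carrier A" "y \<in> carrier A" "x \<preceq> y" "y \<preceq> x"
  shows "x = y"
  using divisibility[of x y] assms by simp

text \<open>By divisibility an element \<open>x\<close> below \<open>y\<close> is the multiple
  \<open>(y \<leadsto> x) \<otimes> y\<close>, and residuation pulls the factor out of the
  implication.\<close>

lemma hle_trans:
  assumes "x \<in> carrier A" "y \<in> carrier A" "z \<in> carrier A" "x \<preceq> y" "y \<preceq> z"
  shows "x \<preceq> z"
proof -
  have "x = (y \<leadsto> x) \<otimes> y"
    using divisibility[of x y] assms by (simp add: imp_closed m_comm)
  then have "x \<leadsto> z = (y \<leadsto> x) \<leadsto> (y \<leadsto> z)"
    using residuation[of "y \<leadsto> x" y z] assms by (simp add: imp_closed)
  then show ?thesis using assms by (simp add: imp_closed imp_one)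
qed

lemma mult_hle_left: "\<lbrakk>x \<in> carrier A; y \<in> carrier A\<rbrakk> \<Longrightarrow> x \<otimes> y \<preceq> x"
  using residuation[of y x x] by (simp add: imp_refl imp_one m_comm)

lemma mult_hle_right: "\<lbrakk>x \<in> carrier A; y \<in> carrier A\<rbrakk> \<Longrightarrow> x \<otimes> y \<preceq> y"
  using residuation[of x y y] by (simp add: imp_refl imp_one)

lemma hle_imp: "\<lbrakk>x \<in> carrier A; y \<in> carrier A\<rbrakk> \<Longrightarrow> y \<preceq> x \<leadsto> y"
  using residuation[of y x y] by (simp add: mult_hle_left)

lemma modus_ponens: "\<lbrakk>x \<in> carrier A; y \<in> carrier A\<rbrakk> \<Longrightarrow> (x \<leadsto> y) \<otimes> x \<preceq> y"
  using residuation[of "x \<leadsto> y" x y] by (simp add: imp_closed imp_refl)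

lemma mult_mono_hle:
  assumes "x \<in> carrier A" "y \<in> carrier A" "z \<in> carrier A" "y \<preceq> z"
  shows "y \<otimes> x \<preceq> z \<otimes> x"
proof -
  have "z \<preceq> x \<leadsto> (z \<otimes> x)"
    using residuation[of z x "z \<otimes> x"] assms by (simp add: imp_refl)
  then have "y \<preceq> x \<leadsto> (z \<otimes> x)"
    using hle_trans[of y z "x \<leadsto> (z \<otimes> x)"] assms by (simp add: imp_closed)
  then show ?thesis using residuation[of y x "z \<otimes> x"] assms by simp
qed

lemma mult_mono2_hle:
  assumes "x \<in> carrier A" "y \<in> carrier A" "x' \<in> carrier A" "y' \<in> carrier A"
    and "x \<preceq> x'" "y \<preceq> y'"
  shows "x \<otimes> y \<preceq> x' \<otimes> y'"
proof -
  have "x \<otimes> y \<preceq> x' \<otimes> y" "x' \<otimes> y \<preceq> x' \<otimes> y'"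
    using assms mult_mono_hle[of y x x'] mult_mono_hle[of x' y y'] by (simp_all add: m_comm)
  then show ?thesis using assms hle_trans[of "x \<otimes> y" "x' \<otimes> y"] by simp
qed

lemma imp_mono_hle:
  assumes "x \<in> carrier A" "y \<in> carrier A" "z \<in> carrier A" "y \<preceq> z"
  shows "x \<leadsto> y \<preceq> x \<leadsto> z"
proof -
  have "(x \<leadsto> y) \<otimes> x \<preceq> z"
    using modus_ponens[of x y] hle_trans[of "(x \<leadsto> y) \<otimes> x" y z] assms by (simp add: imp_closed)
  then show ?thesis using residuation[of "x \<leadsto> y" x z] assms by (simp add: imp_closed)
qed

lemma imp_antimono_hle:
  assumes "x \<in> carrier A" "y \<in> carrier A" "z \<in> carrier A" "x \<preceq> y"
  shows "y \<leadsto> z \<preceq> x \<leadsto> z"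
proof -
  have "x \<otimes> (y \<leadsto> z) \<preceq> z"
    using mult_mono_hle[of "y \<leadsto> z" x y] modus_ponens[of y z] assms
      hle_trans[of "x \<otimes> (y \<leadsto> z)" "y \<otimes> (y \<leadsto> z)" z] by (simp add: imp_closed m_comm)
  then show ?thesis using residuation[of "y \<leadsto> z" x z] assms by (simp add: imp_closed m_comm)
qed

lemma imp_imp_eq:
  assumes "x \<in> carrier A" "y \<in> carrier A" "y \<preceq> x"
  shows "(x \<leadsto> y) \<leadsto> y = x"
  using wajsberg[of x y] assms by (simp add: one_imp)

lemma mult_imp_eq:
  assumes "x \<in> carrier A" "y \<in> carrier A" "y \<preceq> x"
  shows "x \<otimes> (x \<leadsto> y) = y"
  using divisibility[of x y] assms by simp

lemma imp_triple:
  assumes "x \<in> carrier A" "y \<in> carrier A"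
  shows "((x \<leadsto> y) \<leadsto> y) \<leadsto> y = x \<leadsto> y"
  using imp_imp_eq[of "x \<leadsto> y" y] hle_imp[of x y] assms by (simp add: imp_closed)

lemma join_least:
  assumes "x \<in> carrier A" "y \<in> carrier A" "z \<in> carrier A" "x \<preceq> z" "y \<preceq> z"
  shows "(x \<leadsto> y) \<leadsto> y \<preceq> z"
proof -
  have "z \<leadsto> y \<preceq> x \<leadsto> y" using assms imp_antimono_hle by simp
  then have "(x \<leadsto> y) \<leadsto> y \<preceq> (z \<leadsto> y) \<leadsto> y"
    using assms imp_antimono_hle by (simp add: imp_closed)
  then show ?thesis using assms imp_imp_eq by simp
qed

text \<open>Both implications are unchanged when the antecedent is replaced by \<open>x \<or> y\<close>.\<close>
lemma prelinearity:
  assumes x: "x \<in> carrier A" and y: "y \<in> carrier A"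
  shows "(x \<leadsto> y) \<leadsto> (y \<leadsto> x) = y \<leadsto> x"
proof -
  define w where "w = (x \<leadsto> y) \<leadsto> y"
  have w: "w \<in> carrier A" using x y by (simp add: w_def imp_closed)
  have wy: "w \<leadsto> y = x \<leadsto> y" using imp_triple x y by (simp add: w_def)
  have wx: "w \<leadsto> x = y \<leadsto> x"
    using imp_triple x y wajsberg[of x y] by (simp add: w_def)
  have yw: "y \<preceq> w" using hle_imp x y by (simp add: w_def imp_closed)
  have "(x \<leadsto> y) \<leadsto> (y \<leadsto> x) = (w \<otimes> (w \<leadsto> y)) \<leadsto> x"
    using residuation[of "w \<leadsto> y" w x] w x y
    by (simp add: wx m_comm imp_closed flip: wy)
  then show ?thesis using mult_imp_eq[of w y] yw w y by simp
qed

text \<open>The equation \<open>a \<leadsto> b = b\<close> says that the join of \<open>a\<close>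
  and \<open>b\<close> is 1. In this form it passes to powers by residuation and is symmetric, which
  carries prelinearity over to powers.\<close>

lemma pow_imp_eq:
  assumes "a \<in> carrier A" "b \<in> carrier A" "a \<leadsto> b = b"
  shows "(a [^] (k::nat)) \<leadsto> b = b"
proof (induction k)
  case 0
  then show ?case using assms by (simp add: one_imp)
next
  case (Suc k)
  then show ?case using assms residuation[of "a [^] k" a b] by simp
qed

lemma imp_eq_sym:
  assumes "a \<in> carrier A" "b \<in> carrier A" "a \<leadsto> b = b"
  shows "b \<leadsto> a = a"
proof -
  have "b \<leadsto> a \<preceq> a" using wajsberg[of a b] assms by (simp add: imp_refl)
  then show ?thesis
    using hle_antisym[of "b \<leadsto> a" a] hle_imp[of b a] assms by (simp add: imp_closed)
qed

lemma eval_closed: "(\<And>v. v \<in> vars t \<Longrightarrow> e v \<in> carrier A) \<Longrightarrow> eval A e t \<in> carrier A"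
  by (induction t) (auto simp: imp_closed meet_eq join_eq)

end

lemma eval_cong: "(\<And>v. v \<in> vars t \<Longrightarrow> e v = e' v) \<Longrightarrow> eval A e t = eval A e' t"
  by (induction t) auto

lemma quasi_holdsI:
  assumes "vars t \<subseteq> {..<n}" "vars u \<subseteq> {..<n}"
    and "\<And>e. \<lbrakk>\<And>i. i < n \<Longrightarrow> e i \<in> carrier A; eval A e t = \<one>\<^bsub>A\<^esub>\<rbrakk> \<Longrightarrow> eval A e u = \<one>\<^bsub>A\<^esub>"
  shows "quasi_holds A n t u"
  using assms unfolding quasi_holds_def by (auto simp: PiE_iff)

lemma quasi_holdsD:
  assumes "quasi_holds A n t u" "vars t \<subseteq> {..<n}" "vars u \<subseteq> {..<n}"
    and "\<And>i. i < n \<Longrightarrow> e i \<in> carrier A" "eval A e t = \<one>\<^bsub>A\<^esub>"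
  shows "eval A e u = \<one>\<^bsub>A\<^esub>"
proof -
  let ?e = "restrict e {..<n}"
  have "eval A ?e t = eval A e t" "eval A ?e u = eval A e u"
    using assms(2,3) by (intro eval_cong; auto)+
  moreover have "?e \<in> {..<n} \<rightarrow>\<^sub>E carrier A" using assms(4) by auto
  ultimately show ?thesis using assms(1,5) unfolding quasi_holds_def by metis
qed

lemma one_set_subset_iff:
  "one_set n t \<subseteq> one_set n u \<longleftrightarrow> quasi_holds standard_hoop n t u"
  by (auto simp: one_set_def quasi_holds_def term_fun_def standard_hoop_def)

section \<open>Intervals\<close>

text \<open>The multiplication is \<open>(x \<cdot> y) \<or> m\<close>, written as a double negation relative to \<open>m\<close>.\<close>
definition interval_mv :: "('a, 'b) hoop_scheme \<Rightarrow> 'a \<Rightarrow> 'a mv" where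
  "interval_mv A m =
    \<lparr>carrier = {x \<in> carrier A. m \<leadsto>\<^bsub>A\<^esub> x = \<one>\<^bsub>A\<^esub>},
     monoid.mult = (\<lambda>x y. ((x \<otimes>\<^bsub>A\<^esub> y) \<leadsto>\<^bsub>A\<^esub> m) \<leadsto>\<^bsub>A\<^esub> m),
     one = \<one>\<^bsub>A\<^esub>,
     himp = himp A,
     hmeet = hmeet A,
     hjoin = hjoin A,
     hzero = m\<rparr>"

context wajsberg_hoop
begin

lemma mv_algebra_interval:
  assumes m: "m \<in> carrier A"
  shows "mv_algebra (interval_mv A m)"
proof -
  \<comment> \<open>Replacing \<open>x\<close> by its join with \<open>m\<close> does not affect
    implications into elements above \<open>m\<close>: write \<open>z\<close> as a double negation
    relative to \<open>m\<close>, exchange, and collapse the triple negation.\<close>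
  have dn: "((x \<leadsto> m) \<leadsto> m) \<leadsto> z = x \<leadsto> z"
    if "x \<in> carrier A" "z \<in> carrier A" "m \<preceq> z" for x z
  proof -
    have "z = (z \<leadsto> m) \<leadsto> m" using that m imp_imp_eq by simp
    moreover have "((x \<leadsto> m) \<leadsto> m) \<leadsto> ((z \<leadsto> m) \<leadsto> m) = x \<leadsto> ((z \<leadsto> m) \<leadsto> m)"
      using exchange[of "(x \<leadsto> m) \<leadsto> m" "z \<leadsto> m" m] exchange[of x "z \<leadsto> m" m] that m
      by (simp add: imp_closed imp_triple)
    ultimately show ?thesis by simp
  qed
  have up: "m \<preceq> x \<leadsto> y" if "x \<in> carrier A" "y \<in> carrier A" "m \<preceq> y" for x y
    using hle_trans[of m y "x \<leadsto> y"] hle_imp[of x y] that m by (simp add: imp_closed)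
  \<comment> \<open>With \<open>right\<close>, this removes an inner truncation under an outer one,
    so associativity reduces to that of \<open>A\<close>.\<close>
  have left: "(((x \<leadsto> m) \<leadsto> m) \<otimes> z) \<leadsto> m = (x \<otimes> z) \<leadsto> m"
    if "x \<in> carrier A" "z \<in> carrier A" for x z
  proof -
    have "(((x \<leadsto> m) \<leadsto> m) \<otimes> z) \<leadsto> m = ((x \<leadsto> m) \<leadsto> m) \<leadsto> (z \<leadsto> m)"
      using that m by (simp add: residuation imp_closed)
    also have "\<dots> = x \<leadsto> (z \<leadsto> m)"
      using that m dn[of x "z \<leadsto> m"] hle_imp[of z m] by (simp add: imp_closed)
    finally show ?thesis using that m by (simp add: residuation)
  qed
  have right: "(z \<otimes> ((x \<leadsto> m) \<leadsto> m)) \<leadsto> m = (z \<otimes> x) \<leadsto> m"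
    if "x \<in> carrier A" "z \<in> carrier A" for x z
    using left[OF that] that m by (simp add: m_comm imp_closed)
  \<comment> \<open>The product defining the meet is not truncated, since it lies above
    \<open>x \<otimes> (x \<leadsto> m)\<close>, which is \<open>m\<close>.\<close>
  have meet: "((x \<otimes> (x \<leadsto> y)) \<leadsto> m) \<leadsto> m = x \<otimes> (x \<leadsto> y)"
    if "x \<in> carrier A" "y \<in> carrier A" "m \<preceq> x" "m \<preceq> y" for x y
  proof -
    have "x \<leadsto> m \<preceq> x \<leadsto> y" using that m by (simp add: imp_mono_hle)
    then have "x \<otimes> (x \<leadsto> m) \<preceq> x \<otimes> (x \<leadsto> y)"
      using that m mult_mono_hle[of x "x \<leadsto> m" "x \<leadsto> y"] by (simp add: m_comm imp_closed)
    then show ?thesis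
      using that m mult_imp_eq[of x m] by (simp add: imp_imp_eq imp_closed)
  qed
  have dn_id: "(x \<leadsto> m) \<leadsto> m = x" if "x \<in> carrier A" "m \<preceq> x" for x
    using that m imp_imp_eq by simp
  show ?thesis
  proof (unfold_locales, goal_cases)
    case (1 x y)
    then show ?case using m hle_imp by (simp add: interval_mv_def imp_closed)
  next
    case (2 x y z)
    then show ?case
      using m left[of "x \<otimes> y" z] right[of "y \<otimes> z" x]
      by (simp add: interval_mv_def m_assoc)
  next
    case (4 x)
    then show ?case using dn_id by (simp add: interval_mv_def)
  next
    case (5 x)
    then show ?case using dn_id by (simp add: interval_mv_def)
  next
    case (9 x y)
    then show ?case
      using meet[of x y] meet[of y x] divisibility[of x y] by (simp add: interval_mv_def)
  next
    case (10 x y z)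
    then show ?case using dn[of "x \<otimes> y" z] by (simp add: interval_mv_def residuation)
  next
    case (11 x y)
    then show ?case using wajsberg[of x y] by (simp add: interval_mv_def)
  next
    case (12 x y)
    then show ?case using meet[of x y] by (simp add: interval_mv_def meet_eq)
  qed (simp_all add: interval_mv_def m imp_closed imp_refl imp_one up join_eq m_comm)
qed

text \<open>Only products differ between the two algebras, and they agree once \<open>m\<close> is
  below the product in \<open>A\<close>. For every operation the product of the bounds of the two
  subterms is a suitable bound: it keeps \<open>m\<close> below the product of the two values, and
  the results of the other operations lie above the second value or above that product.\<close>

lemma exists_eval_interval:
  assumes "\<And>v. v \<in> vars t \<Longrightarrow> e v \<in> carrier A"
  shows "\<exists>b\<in>carrier A. \<forall>m\<in>carrier A. m \<preceq> b \<longrightarrow>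
    eval (interval_mv A m) e t = eval A e t \<and> m \<preceq> eval A e t"
proof -
  define R where "R b m t \<longleftrightarrow> (m \<preceq> b \<longrightarrow>
    eval (interval_mv A m) e t = eval A e t \<and> m \<preceq> eval A e t)" for b m t
  have bin: "\<exists>b\<in>carrier A. \<forall>m\<in>carrier A. R b m (f s t)"
    if s: "\<exists>b\<in>carrier A. \<forall>m\<in>carrier A. R b m s" and t: "\<exists>b\<in>carrier A. \<forall>m\<in>carrier A. R b m t"
      and step: "\<And>m. \<lbrakk>m \<in> carrier A; eval (interval_mv A m) e s = eval A e s;
        eval (interval_mv A m) e t = eval A e t; m \<preceq> eval A e t; m \<preceq> eval A e s \<otimes> eval A e t\<rbrakk>
        \<Longrightarrow> eval (interval_mv A m) e (f s t) = eval A e (f s t) \<and> m \<preceq> eval A e (f s t)"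
      and cl: "eval A e s \<in> carrier A" "eval A e t \<in> carrier A"
    for f :: "'c wh_term \<Rightarrow> 'c wh_term \<Rightarrow> 'c wh_term" and s t
  proof -
    obtain b c where b: "b \<in> carrier A" "\<forall>m\<in>carrier A. R b m s"
      and c: "c \<in> carrier A" "\<forall>m\<in>carrier A. R c m t" using s t by blast
    have "R (b \<otimes> c) m (f s t)" if m: "m \<in> carrier A" for m
    proof -
      have "eval (interval_mv A m) e (f s t) = eval A e (f s t) \<and> m \<preceq> eval A e (f s t)"
        if "m \<preceq> b \<otimes> c"
      proof (rule step[OF m])
        have "m \<preceq> b" "m \<preceq> c"
          using that hle_trans[OF m, of "b \<otimes> c"] mult_hle_left mult_hle_right b(1) c(1)
          by auto
        then show "eval (interval_mv A m) e s = eval A e s"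
          "eval (interval_mv A m) e t = eval A e t" "m \<preceq> eval A e t"
          using b c m by (auto simp: R_def)
        \<comment> \<open>The bounds are themselves admissible values of \<open>m\<close>, so the
          two hypotheses apply to \<open>b\<close> and \<open>c\<close>.\<close>
        have "b \<preceq> eval A e s" "c \<preceq> eval A e t"
          using b c by (auto simp: R_def imp_refl)
        then have "b \<otimes> c \<preceq> eval A e s \<otimes> eval A e t"
          using b(1) c(1) cl by (simp add: mult_mono2_hle)
        then show "m \<preceq> eval A e s \<otimes> eval A e t"
          using that m b(1) c(1) cl hle_trans[of m "b \<otimes> c"] by simp
      qed
      then show ?thesis by (simp add: R_def)
    qed
    then show ?thesis using b(1) c(1) by blast
  qed
  have "\<exists>b\<in>carrier A. \<forall>m\<in>carrier A. R b m t" using assms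
  proof (induction t)
    case (Var v)
    then show ?case by (auto simp: R_def)
  next
    case One
    then show ?case by (auto simp: R_def interval_mv_def imp_one)
  next
    case (Times s t)
    then have cl: "eval A e s \<in> carrier A" "eval A e t \<in> carrier A" by (auto intro: eval_closed)
    have IH: "\<exists>b\<in>carrier A. \<forall>m\<in>carrier A. R b m s" "\<exists>b\<in>carrier A. \<forall>m\<in>carrier A. R b m t"
      using Times by auto
    show ?case
    proof (rule bin[OF IH _ cl], goal_cases)
      case (1 m)
      then show ?case
        using cl imp_imp_eq[of "eval A e s \<otimes> eval A e t" m]
        by (simp add: interval_mv_def)
    qed
  next
    case (Imp s t)
    then have cl: "eval A e s \<in> carrier A" "eval A e t \<in> carrier A" by (auto intro: eval_closed)
    have IH: "\<exists>b\<in>carrier A. \<forall>m\<in>carrier A. R b m s" "\<exists>b\<in>carrier A. \<forall>m\<in>carrier A. R b m t"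
      using Imp by auto
    show ?case
    proof (rule bin[OF IH _ cl], goal_cases)
      case (1 m)
      then show ?case
        using cl hle_trans[of m "eval A e t" "eval A e s \<leadsto> eval A e t"]
        by (simp add: interval_mv_def imp_closed hle_imp)
    qed
  next
    case (Meet s t)
    then have cl: "eval A e s \<in> carrier A" "eval A e t \<in> carrier A" by (auto intro: eval_closed)
    have IH: "\<exists>b\<in>carrier A. \<forall>m\<in>carrier A. R b m s" "\<exists>b\<in>carrier A. \<forall>m\<in>carrier A. R b m t"
      using Meet by auto
    have le: "eval A e s \<otimes> eval A e t \<preceq> eval A e s \<otimes> (eval A e s \<leadsto> eval A e t)"
      using cl by (simp add: mult_mono2_hle imp_refl hle_imp imp_closed)
    show ?case
    proof (rule bin[OF IH _ cl], goal_cases)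
      case (1 m)
      then show ?case
        using cl le hle_trans[of m "eval A e s \<otimes> eval A e t" "eval A e s \<otimes> (eval A e s \<leadsto> eval A e t)"]
        by (simp add: interval_mv_def imp_closed meet_eq)
    qed
  next
    case (Join s t)
    then have cl: "eval A e s \<in> carrier A" "eval A e t \<in> carrier A" by (auto intro: eval_closed)
    have IH: "\<exists>b\<in>carrier A. \<forall>m\<in>carrier A. R b m s" "\<exists>b\<in>carrier A. \<forall>m\<in>carrier A. R b m t"
      using Join by auto
    show ?case
    proof (rule bin[OF IH _ cl], goal_cases)
      case (1 m)
      then show ?case
        using cl hle_trans[of m "eval A e t" "(eval A e s \<leadsto> eval A e t) \<leadsto> eval A e t"]
        by (simp add: interval_mv_def imp_closed hle_imp join_eq)
    qed
  qed
  then show ?thesis by (simp add: R_def)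
qed

lemma exists_lower_bound:
  assumes "\<And>i. i < n \<Longrightarrow> e i \<in> carrier A"
  shows "\<exists>m\<in>carrier A. \<forall>i<(n::nat). m \<preceq> e i"
  using assms
proof (induction n)
  case 0
  then show ?case by auto
next
  case (Suc n)
  then obtain m where m: "m \<in> carrier A" "\<forall>i<n. m \<preceq> e i" by fastforce
  have "m \<otimes> e n \<preceq> e i" if "i < Suc n" for i
    using that m Suc.prems hle_trans[of "m \<otimes> e n" m "e i"]
    by (cases "i = n") (auto simp: mult_hle_left mult_hle_right)
  then show ?case using m Suc.prems by (intro bexI[of _ "m \<otimes> e n"]) auto
qed

end

lemma (in wajsberg_hoop) quasi_holds_if_intervals:
  assumes t: "vars t \<subseteq> {..<n}" and u: "vars u \<subseteq> {..<n}"
    and mv: "\<And>m. m \<in> carrier A \<Longrightarrow> quasi_holds (interval_mv A m) n t u"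
  shows "quasi_holds A n t u"
proof (rule quasi_holdsI[OF t u])
  fix e assume e: "\<And>i. i < n \<Longrightarrow> e i \<in> carrier A" and et: "eval A e t = \<one>"
  obtain b where b: "b \<in> carrier A" "\<And>m. m \<in> carrier A \<Longrightarrow> m \<preceq> b \<Longrightarrow>
      eval (interval_mv A m) e t = eval A e t"
    using exists_eval_interval[of t e] e t by blast
  obtain c where c: "c \<in> carrier A" "\<And>m. m \<in> carrier A \<Longrightarrow> m \<preceq> c \<Longrightarrow>
      eval (interval_mv A m) e u = eval A e u"
    using exists_eval_interval[of u e] e u by blast
  obtain d where d: "d \<in> carrier A" "\<And>i. i < n \<Longrightarrow> d \<preceq> e i"
    using exists_lower_bound[of n e] e by blast
  \<comment> \<open>The factors \<open>b\<close> and \<open>c\<close> protect the evaluations of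
    \<open>t\<close> and \<open>u\<close>; the factor \<open>d\<close> puts the whole assignment
    into the interval, including variables that occur in neither term.\<close>
  define m where "m = b \<otimes> c \<otimes> d"
  have m: "m \<in> carrier A" using b(1) c(1) d(1) by (simp add: m_def)
  have "m \<preceq> b \<otimes> c" "m \<preceq> d"
    using b(1) c(1) d(1) by (simp_all add: m_def mult_hle_left mult_hle_right)
  then have le: "m \<preceq> b" "m \<preceq> c" "m \<preceq> d"
    using hle_trans[OF m, of "b \<otimes> c"] b(1) c(1) mult_hle_left mult_hle_right by auto
  then have le_e: "m \<preceq> e i" if "i < n" for i
    using hle_trans[OF m d(1) e[OF that] _ d(2)[OF that]] by simp
  have "eval (interval_mv A m) e t = \<one>\<^bsub>interval_mv A m\<^esub>"
    using b(2)[OF m le(1)] et by (simp add: interval_mv_def)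
  moreover have "e i \<in> carrier (interval_mv A m)" if "i < n" for i
    using le_e[OF that] e[OF that] by (simp add: interval_mv_def)
  ultimately have "eval (interval_mv A m) e u = \<one>\<^bsub>interval_mv A m\<^esub>"
    using quasi_holdsD[OF mv[OF m] t u] by blast
  then show "eval A e u = \<one>" using c(2)[OF m le(2)] by (simp add: interval_mv_def)
qed

text \<open>Forgetting the constant turns an MV-algebra into a hoop, and the intervals of a hoop are
  MV-algebras. Neither construction changes the element type, so the same \<open>'a\<close> appears
  on both sides.\<close>

lemma WH_valid_iff_MV_valid:
  assumes t: "vars t \<subseteq> {..<n}" and u: "vars u \<subseteq> {..<n}"
  shows "WH_valid TYPE('a) n t u \<longleftrightarrow> MV_valid TYPE('a) n t u"
proof
  assume wh: "WH_valid TYPE('a) n t u"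
  show "MV_valid TYPE('a) n t u" unfolding MV_valid_def
  proof (intro allI impI)
    fix A :: "'a mv" assume "mv_algebra A"
    then interpret mv_algebra A .
    let ?B = "hoop.truncate A"
    have "wajsberg_hoop ?B"
      by unfold_locales
        (simp_all add: hoop.truncate_def imp_closed imp_refl m_ac residuation meet_eq join_eq
          divisibility wajsberg)
    then have "quasi_holds ?B n t u" using wh unfolding WH_valid_def by blast
    moreover have "eval ?B e s = eval A e s" for e and s :: "nat wh_term"
      by (induction s) (auto simp: hoop.truncate_def)
    ultimately show "quasi_holds A n t u"
      by (simp add: quasi_holds_def hoop.truncate_def)
  qed
next
  assume mv: "MV_valid TYPE('a) n t u"
  show "WH_valid TYPE('a) n t u" unfolding WH_valid_def
  proof (intro allI impI)
    fix A :: "'a hoop" assume "wajsberg_hoop A"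
    then interpret wajsberg_hoop A .
    show "quasi_holds A n t u"
      using mv mv_algebra_interval t u unfolding MV_valid_def
      by (intro quasi_holds_if_intervals) blast+
  qed
qed

section \<open>Homomorphic images\<close>

text \<open>Serves two purposes: a class map as \<open>\<phi>\<close> gives a quotient, and an
  injective \<open>\<phi>\<close> transports an algebra to another type. The operations act on
  representatives chosen by \<open>inv_into\<close>.\<close>

definition image_mv :: "('a \<Rightarrow> 'c) \<Rightarrow> ('a, 'b) mv_scheme \<Rightarrow> 'c mv" where
  "image_mv \<phi> A = (let g = inv_into (carrier A) \<phi> in
    \<lparr>carrier = \<phi> ` carrier A,
     monoid.mult = (\<lambda>x y. \<phi> (g x \<otimes>\<^bsub>A\<^esub> g y)),
     one = \<phi> \<one>\<^bsub>A\<^esub>,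
     himp = (\<lambda>x y. \<phi> (g x \<leadsto>\<^bsub>A\<^esub> g y)),
     hmeet = (\<lambda>x y. \<phi> (g x \<curlywedge>\<^bsub>A\<^esub> g y)),
     hjoin = (\<lambda>x y. \<phi> (g x \<curlyvee>\<^bsub>A\<^esub> g y)),
     hzero = \<phi> \<zero>\<^bsub>A\<^esub>\<rparr>)"

locale mv_congruence = mv_algebra A for A (structure) +
  fixes \<phi> :: "'a \<Rightarrow> 'c"
  assumes mult_cong: "\<lbrakk>x \<in> carrier A; x' \<in> carrier A; y \<in> carrier A; y' \<in> carrier A;
      \<phi> x = \<phi> x'; \<phi> y = \<phi> y'\<rbrakk> \<Longrightarrow> \<phi> (x \<otimes> y) = \<phi> (x' \<otimes> y')"
    and imp_cong: "\<lbrakk>x \<in> carrier A; x' \<in> carrier A; y \<in> carrier A; y' \<in> carrier A;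
      \<phi> x = \<phi> x'; \<phi> y = \<phi> y'\<rbrakk> \<Longrightarrow> \<phi> (x \<leadsto> y) = \<phi> (x' \<leadsto> y')"
begin

abbreviation "B \<equiv> image_mv \<phi> A"

lemma section_carrier:
  assumes "x \<in> carrier A"
  shows "inv_into (carrier A) \<phi> (\<phi> x) \<in> carrier A" "\<phi> (inv_into (carrier A) \<phi> (\<phi> x)) = \<phi> x"
  using assms by (simp_all add: inv_into_into f_inv_into_f)

lemma image_simps:
  shows "carrier B = \<phi> ` carrier A"
    and "\<one>\<^bsub>B\<^esub> = \<phi> \<one>"
    and "hzero B = \<phi> \<zero>"
    and "\<lbrakk>x \<in> carrier A; y \<in> carrier A\<rbrakk> \<Longrightarrow> \<phi> x \<otimes>\<^bsub>B\<^esub> \<phi> y = \<phi> (x \<otimes> y)"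
    and "\<lbrakk>x \<in> carrier A; y \<in> carrier A\<rbrakk> \<Longrightarrow> \<phi> x \<leadsto>\<^bsub>B\<^esub> \<phi> y = \<phi> (x \<leadsto> y)"
    and "\<lbrakk>x \<in> carrier A; y \<in> carrier A\<rbrakk> \<Longrightarrow> \<phi> x \<curlywedge>\<^bsub>B\<^esub> \<phi> y = \<phi> (x \<curlywedge> y)"
    and "\<lbrakk>x \<in> carrier A; y \<in> carrier A\<rbrakk> \<Longrightarrow> \<phi> x \<curlyvee>\<^bsub>B\<^esub> \<phi> y = \<phi> (x \<curlyvee> y)"
proof -
  let ?g = "inv_into (carrier A) \<phi>"
  have mult: "\<phi> (?g (\<phi> x) \<otimes> ?g (\<phi> y)) = \<phi> (x \<otimes> y)"
    and imp: "\<phi> (?g (\<phi> x) \<leadsto> ?g (\<phi> y)) = \<phi> (x \<leadsto> y)"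
    and meet: "\<phi> (?g (\<phi> x) \<otimes> (?g (\<phi> x) \<leadsto> ?g (\<phi> y))) = \<phi> (x \<otimes> (x \<leadsto> y))"
    and join: "\<phi> ((?g (\<phi> x) \<leadsto> ?g (\<phi> y)) \<leadsto> ?g (\<phi> y)) = \<phi> ((x \<leadsto> y) \<leadsto> y)"
    if "x \<in> carrier A" "y \<in> carrier A" for x y
    using that by (blast intro: mult_cong imp_cong section_carrier imp_closed)+
  show "carrier B = \<phi> ` carrier A" "\<one>\<^bsub>B\<^esub> = \<phi> \<one>" "hzero B = \<phi> \<zero>"
    by (simp_all add: image_mv_def Let_def)
  assume "x \<in> carrier A" "y \<in> carrier A"
  then show "\<phi> x \<otimes>\<^bsub>B\<^esub> \<phi> y = \<phi> (x \<otimes> y)" "\<phi> x \<leadsto>\<^bsub>B\<^esub> \<phi> y = \<phi> (x \<leadsto> y)"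
    "\<phi> x \<curlywedge>\<^bsub>B\<^esub> \<phi> y = \<phi> (x \<curlywedge> y)" "\<phi> x \<curlyvee>\<^bsub>B\<^esub> \<phi> y = \<phi> (x \<curlyvee> y)"
    by (simp_all add: image_mv_def Let_def meet_eq join_eq section_carrier(1) mult imp meet join)
qed

lemma mv_algebra_image: "mv_algebra B"
proof (unfold_locales, goal_cases)
  case (2 x y z)
  then show ?case by (auto simp: image_simps m_assoc)
next
  case (6 x y)
  then obtain a b where "a \<in> carrier A" "b \<in> carrier A" "x = \<phi> a" "y = \<phi> b"
    by (auto simp: image_simps)
  then show ?case using m_comm[of a b] by (simp add: image_simps)
next
  case (9 x y)
  then obtain a b where "a \<in> carrier A" "b \<in> carrier A" "x = \<phi> a" "y = \<phi> b"
    by (auto simp: image_simps)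
  then show ?case using divisibility[of a b] by (simp add: image_simps imp_closed)
next
  case (11 x y)
  then obtain a b where "a \<in> carrier A" "b \<in> carrier A" "x = \<phi> a" "y = \<phi> b"
    by (auto simp: image_simps)
  then show ?case using wajsberg[of a b] by (simp add: image_simps imp_closed)
qed (auto simp: image_simps imp_closed imp_refl residuation meet_eq join_eq zero_closed zero_least)

lemma eval_image:
  assumes "\<And>v. v \<in> vars t \<Longrightarrow> e v \<in> carrier A"
  shows "eval B (\<lambda>v. \<phi> (e v)) t = \<phi> (eval A e t)"
  using assms by (induction t) (simp_all add: image_simps eval_closed)

end

section \<open>Countable subalgebras of the standard algebra\<close>

instance wh_term :: (countable) countable
  by countable_datatype

text \<open>This is an MV-algebra only if \<open>x\<close> takes the value \<open>0\<close>, since terms do not contain that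
  constant.\<close>
definition generated_mv :: "(nat \<Rightarrow> real) \<Rightarrow> real mv" where
  "generated_mv x = hoop.extend (standard_hoop\<lparr>carrier := range (eval standard_hoop x)\<rparr>) (mv.fields 0)"

lemma mv_algebra_generated:
  assumes x: "\<And>i. x i \<in> {0..1}" and zero: "x k = 0"
  shows "mv_algebra (generated_mv x)"
proof -
  interpret S: wajsberg_hoop standard_hoop by (rule wajsberg_hoop_standard)
  define V where "V = range (eval standard_hoop x)"
  have R: "0 \<le> a \<and> a \<le> 1" if "a \<in> V" for a
    using that S.eval_closed[of _ x] x by (fastforce simp: V_def standard_hoop_def)
  have closed: "max 0 (a + b - 1) \<in> V" "min 1 (1 - a + b) \<in> V" if ab: "a \<in> V" "b \<in> V" for a b
  proof -
    obtain s t where "a = eval standard_hoop x s" "b = eval standard_hoop x t" using ab unfolding V_def by blast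
    then have "max 0 (a + b - 1) = eval standard_hoop x (Times s t)"
      "min 1 (1 - a + b) = eval standard_hoop x (Imp s t)"
      by (simp_all add: standard_hoop_def)
    then show "max 0 (a + b - 1) \<in> V" "min 1 (1 - a + b) \<in> V" unfolding V_def by (metis rangeI)+
  qed
  have "1 = eval standard_hoop x One" "0 = eval standard_hoop x (Var k)"
    using zero by (simp_all add: standard_hoop_def)
  then have c01: "1 \<in> V" "0 \<in> V" unfolding V_def by (metis rangeI)+
  have simps: "carrier (generated_mv x) = V" "\<one>\<^bsub>generated_mv x\<^esub> = 1"
    "hzero (generated_mv x) = 0"
    "a \<otimes>\<^bsub>generated_mv x\<^esub> b = max 0 (a + b - 1)" "a \<leadsto>\<^bsub>generated_mv x\<^esub> b = min 1 (1 - a + b)"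
    "a \<curlywedge>\<^bsub>generated_mv x\<^esub> b = min a b" "a \<curlyvee>\<^bsub>generated_mv x\<^esub> b = max a b" for a b
    by (simp_all add: V_def generated_mv_def hoop.defs mv.defs standard_hoop_def)
  show ?thesis
    by unfold_locales
      (simp_all add: simps closed c01, (fastforce simp: min_def max_def dest!: R)+)
qed

lemma MV_valid_imp_standard:
  assumes t: "vars t \<subseteq> {..<n}" and u: "vars u \<subseteq> {..<n}"
    and inf: "infinite (UNIV :: 'a set)" and mv: "MV_valid TYPE('a) n t u"
  shows "quasi_holds standard_hoop n t u"
proof (rule quasi_holdsI[OF t u])
  fix e assume e: "\<And>i. i < n \<Longrightarrow> e i \<in> carrier standard_hoop"
    and et: "eval standard_hoop e t = \<one>\<^bsub>standard_hoop\<^esub>"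
  \<comment> \<open>Variables from \<open>n\<close> on get the value 0, so \<open>Var n\<close>
    denotes 0 and the generated subalgebra contains it.\<close>
  define x where "x i = (if i < n then e i else 0)" for i
  define A where "A = generated_mv x"
  interpret A: mv_algebra A
    unfolding A_def using e by (intro mv_algebra_generated[of x n]) (auto simp: x_def standard_hoop_def)
  have carrier: "carrier A = range (eval standard_hoop x)"
    by (simp add: A_def generated_mv_def hoop.defs mv.defs)
  have one: "\<one>\<^bsub>A\<^esub> = \<one>\<^bsub>standard_hoop\<^esub>"
    by (simp add: A_def generated_mv_def hoop.defs mv.defs)
  have evalA: "eval A x s = eval standard_hoop x s" for s :: "nat wh_term"
    by (induction s) (simp_all add: A_def generated_mv_def hoop.defs mv.defs standard_hoop_def)
  have xA: "x i \<in> carrier A" for i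
    unfolding carrier by (metis eval.simps(1) rangeI)
  have eq: "eval standard_hoop x s = eval standard_hoop e s" if "vars s \<subseteq> {..<n}" for s
    using that by (intro eval_cong) (auto simp: x_def)
  have "countable (carrier A)" unfolding carrier by simp
  obtain f :: "nat \<Rightarrow> 'a" where f: "inj f" using infinite_countable_subset[OF inf] by auto
  \<comment> \<open>There are countably many terms, so the generated carrier can be enumerated and
    then injected into \<open>'a\<close>.\<close>
  define \<phi> where "\<phi> = f \<circ> to_nat_on (carrier A)"
  have inj: "inj_on \<phi> (carrier A)"
    unfolding \<phi>_def using f \<open>countable (carrier A)\<close>
    by (intro comp_inj_on) (auto intro: inj_on_subset)
  interpret mv_congruence A \<phi>
    by unfold_locales (use inj in \<open>auto dest: inj_onD\<close>)
  have "quasi_holds (image_mv \<phi> A) n t u"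
    using mv mv_algebra_image by (simp add: MV_valid_def)
  then have "eval (image_mv \<phi> A) (\<lambda>i. \<phi> (x i)) u = \<one>\<^bsub>image_mv \<phi> A\<^esub>"
    by (rule quasi_holdsD[OF _ t u]) (use xA et in \<open>auto simp: image_simps eval_image evalA eq t one\<close>)
  then have "\<phi> (eval A x u) = \<phi> \<one>\<^bsub>A\<^esub>"
    using xA by (simp add: eval_image image_simps)
  then have "eval A x u = \<one>\<^bsub>A\<^esub>"
    using inj_onD[OF inj _ A.eval_closed A.one_closed] xA by blast
  then show "eval standard_hoop e u = \<one>\<^bsub>standard_hoop\<^esub>" by (simp add: evalA eq u one)
qed

section \<open>Total preorders on integer vectors\<close>

text \<open>\<open>P\<close> marks the bounds that must be strict. If there are both lower and upper
  bounds, the midpoint of the largest lower and the smallest upper one works: when the two coincide,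
  the hypothesis on strict pairs excludes a strict bound attained there.\<close>

lemma exists_between_bounds:
  fixes l u :: "'i \<Rightarrow> real"
  assumes I: "finite I" and J: "finite J"
    and le: "\<And>i j. \<lbrakk>i \<in> I; j \<in> J\<rbrakk> \<Longrightarrow> l i \<le> u j"
    and less: "\<And>i j. \<lbrakk>i \<in> I; j \<in> J; P i \<or> P j\<rbrakk> \<Longrightarrow> l i < u j"
  shows "\<exists>v. (\<forall>i\<in>I. l i \<le> v \<and> (P i \<longrightarrow> l i < v)) \<and> (\<forall>j\<in>J. v \<le> u j \<and> (P j \<longrightarrow> v < u j))"
proof (cases "I = {} \<or> J = {}")
  case True
  then show ?thesis
  proof
    assume [simp]: "I = {}"
    show ?thesis
    proof (cases "J = {}")
      case False
      have "Min (u ` J) - 1 < u j" if "j \<in> J" for j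
        using Min_le[OF finite_imageI[OF J] imageI[OF that], of u] by linarith
      then show ?thesis by (intro exI[of _ "Min (u ` J) - 1"]) fastforce
    qed simp
  next
    assume [simp]: "J = {}"
    show ?thesis
    proof (cases "I = {}")
      case False
      have "l i < Max (l ` I) + 1" if "i \<in> I" for i
        using Max_ge[OF finite_imageI[OF I] imageI[OF that], of l] by linarith
      then show ?thesis by (intro exI[of _ "Max (l ` I) + 1"]) fastforce
    qed simp
  qed
next
  case False
  define a b where "a = Max (l ` I)" and "b = Min (u ` J)"
  have "a \<in> l ` I" "b \<in> u ` J" unfolding a_def b_def using I J False by simp_all
  then obtain i0 j0 where i0: "i0 \<in> I" "a = l i0" and j0: "j0 \<in> J" "b = u j0" by blast
  have la: "l i \<le> a" if "i \<in> I" for i using that I by (simp add: a_def)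
  have ub: "b \<le> u j" if "j \<in> J" for j using that J by (simp add: b_def)
  have ab: "a \<le> b" using le i0 j0 by simp
  have 1: "l i \<le> (a + b) / 2 \<and> (P i \<longrightarrow> l i < (a + b) / 2)" if "i \<in> I" for i
    using la[OF that] ab less[OF that j0(1)] j0(2) by auto
  have 2: "(a + b) / 2 \<le> u j \<and> (P j \<longrightarrow> (a + b) / 2 < u j)" if "j \<in> J" for j
    using ub[OF that] ab less[OF i0(1) that] i0(2) by auto
  show ?thesis using 1 2 by blast
qed

text \<open>Think of \<open>Q\<close> as the vectors that are nonnegative in some preorder, and of a strict
  constraint as one whose negative is not in \<open>Q\<close>. The proof is Fourier-Motzkin elimination.\<close>
lemma total_preorder_realization:
  fixes Q :: "('i \<Rightarrow> int) set"
  assumes "finite X" and "finite K" and "K \<subseteq> Q"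
    and "\<And>c d. \<lbrakk>c \<in> Q; d \<in> Q\<rbrakk> \<Longrightarrow> (\<lambda>i. c i + d i) \<in> Q"
    and "\<And>c. (\<And>i. i \<notin> X \<Longrightarrow> c i = 0) \<Longrightarrow> c \<in> Q \<or> (\<lambda>i. - c i) \<in> Q"
    and "\<And>c i. \<lbrakk>c \<in> K; i \<notin> X\<rbrakk> \<Longrightarrow> c i = 0"
  shows "\<exists>f. \<forall>c\<in>K. 0 \<le> (\<Sum>i\<in>X. real_of_int (c i) * f i) \<and>
    ((\<lambda>i. - c i) \<notin> Q \<longrightarrow> 0 < (\<Sum>i\<in>X. real_of_int (c i) * f i))"
  using assms
proof (induction X arbitrary: K rule: finite_induct)
  case empty
  \<comment> \<open>Without coordinates every constraint is the zero vector, which is its own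
    negative, so none is strict.\<close>
  have "(\<lambda>i. 0) \<in> Q" using empty.prems(4)[of "\<lambda>i. 0"] by simp
  then have "(\<lambda>i. - c i) \<in> Q" if "c \<in> K" for c
    using empty.prems(5)[OF that] by simp
  then show ?case by simp
next
  case (insert x X)
  note add = insert.prems(3) and total = insert.prems(4) and supp = insert.prems(5)
  have zero: "(\<lambda>i. 0) \<in> Q" using total[of "\<lambda>i. 0"] by simp
  have scale: "(\<lambda>i. int k * c i) \<in> Q" if "c \<in> Q" for c k
  proof (induction k)
    case 0
    then show ?case using zero by simp
  next
    case (Suc k)
    then show ?case using add[OF that Suc] by (simp add: algebra_simps)
  qed
  \<comment> \<open>A positive combination with a strict vector is strict: otherwise adding
    \<open>d\<close> and \<open>k - 1\<close> further copies of \<open>c\<close> would put the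
    negative of \<open>c\<close> into \<open>Q\<close>.\<close>
  have strict: "(\<lambda>i. - (int k * c i + d i)) \<notin> Q"
    if "k > 0" "c \<in> Q" "(\<lambda>i. - c i) \<notin> Q" "d \<in> Q" for k c d
  proof
    assume "(\<lambda>i. - (int k * c i + d i)) \<in> Q"
    then have "(\<lambda>i. - (int k * c i + d i) + d i) \<in> Q" using add that(4) by blast
    then have "(\<lambda>i. (- (int k * c i + d i) + d i) + int (k - 1) * c i) \<in> Q"
      using add scale[OF that(2), of "k - 1"] by blast
    moreover have "(- (int k * c i + d i) + d i) + int (k - 1) * c i = - c i" for i
      using that(1) by (simp add: of_nat_diff algebra_simps)
    ultimately show False using that(3) by simp
  qed
  \<comment> \<open>The coordinate \<open>x\<close> is eliminated. For its value, constraints in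
    \<open>L\<close> give lower bounds, those in \<open>U\<close> upper bounds, and those in
    \<open>Z\<close> none.\<close>
  define Z where "Z = {c \<in> K. c x = 0}"
  define L where "L = {c \<in> K. c x > 0}"
  define U where "U = {c \<in> K. c x < 0}"
  \<comment> \<open>The weights are positive for \<open>c\<close> in \<open>L\<close> and
    \<open>d\<close> in \<open>U\<close>, and they make coordinate \<open>x\<close> cancel. They are
    written as natural numbers so that repeated addition in \<open>Q\<close> covers them.\<close>
  define comb where "comb c d = (\<lambda>i. int (nat (- d x)) * c i + int (nat (c x)) * d i)"
    for c d :: "'i \<Rightarrow> int"
  define K' where "K' = Z \<union> (\<lambda>(c, d). comb c d) ` (L \<times> U)"
  have fin: "finite Z" "finite L" "finite U"
    using insert.prems(1) by (simp_all add: Z_def L_def U_def)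
  have KQ: "c \<in> Q" if "c \<in> K" for c using that insert.prems(2) by blast
  have comb_Q: "comb c d \<in> Q" if "c \<in> Q" "d \<in> Q" for c d
    unfolding comb_def using add scale that by blast
  have "\<exists>f. \<forall>c\<in>K'. 0 \<le> (\<Sum>i\<in>X. real_of_int (c i) * f i) \<and>
    ((\<lambda>i. - c i) \<notin> Q \<longrightarrow> 0 < (\<Sum>i\<in>X. real_of_int (c i) * f i))"
  proof (rule insert.IH)
    show "finite K'" using fin by (simp add: K'_def)
    show "K' \<subseteq> Q" using KQ comb_Q by (auto simp: K'_def Z_def L_def U_def)
    show "c \<in> Q \<or> (\<lambda>i. - c i) \<in> Q" if "\<And>i. i \<notin> X \<Longrightarrow> c i = 0" for c
      using total that by blast
    show "c i = 0" if c: "c \<in> K'" and i: "i \<notin> X" for c i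
    proof (cases "i = x")
      case True
      then show ?thesis using c by (auto simp: K'_def Z_def L_def U_def comb_def)
    next
      case False
      then have 0: "d i = 0" if "d \<in> K" for d using supp[OF that] i by blast
      consider "c \<in> K" | a b where "a \<in> K" "b \<in> K" "c = comb a b"
        using c by (auto simp: K'_def Z_def L_def U_def)
      then show ?thesis by cases (simp_all add: 0 comb_def)
    qed
  qed (use add in blast)
  then obtain f where f: "\<And>c. c \<in> K' \<Longrightarrow> 0 \<le> (\<Sum>i\<in>X. real_of_int (c i) * f i)"
    "\<And>c. \<lbrakk>c \<in> K'; (\<lambda>i. - c i) \<notin> Q\<rbrakk> \<Longrightarrow> 0 < (\<Sum>i\<in>X. real_of_int (c i) * f i)"
    by blast
  define S where "S c = (\<Sum>i\<in>X. real_of_int (c i) * f i)" for c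
  have fS: "0 \<le> S c" "(\<lambda>i. - c i) \<notin> Q \<Longrightarrow> 0 < S c" if "c \<in> K'" for c
    using f that by (simp_all add: S_def)
  \<comment> \<open>The value of coordinate \<open>x\<close> at which the constraint
    \<open>c\<close> becomes an equality, given the solution on \<open>X\<close>.\<close>
  define bound where "bound c = - S c / real_of_int (c x)" for c
  have S_comb: "S (comb c d) = real_of_int (- d x) * S c + real_of_int (c x) * S d"
    if "c \<in> L" "d \<in> U" for c d
    using that by (simp add: S_def comb_def L_def U_def sum.distrib sum_subtractf sum_negf sum_distrib_left algebra_simps)
  have comb_K': "comb c d \<in> K'" if "c \<in> L" "d \<in> U" for c d
    using that by (auto simp: K'_def)
  have bounds: "bound c \<le> bound d" if "c \<in> L" "d \<in> U" for c d
    using fS(1)[OF comb_K'[OF that]] S_comb[OF that] that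
    by (simp add: bound_def L_def U_def field_simps)
  have strict_bounds: "bound c < bound d"
    if cd: "c \<in> L" "d \<in> U" and s: "(\<lambda>i. - c i) \<notin> Q \<or> (\<lambda>i. - d i) \<notin> Q" for c d
  proof -
    have Q: "c \<in> Q" "d \<in> Q" and pos: "nat (- d x) > 0" "nat (c x) > 0"
      using cd KQ by (auto simp: L_def U_def)
    have "(\<lambda>i. - comb c d i) \<notin> Q"
      using s
    proof
      assume "(\<lambda>i. - c i) \<notin> Q"
      then show ?thesis
        unfolding comb_def using strict[OF pos(1) Q(1)] scale[OF Q(2)] by blast
    next
      assume "(\<lambda>i. - d i) \<notin> Q"
      then have "(\<lambda>i. - (int (nat (c x)) * d i + int (nat (- d x)) * c i)) \<notin> Q"
        using strict[OF pos(2) Q(2)] scale[OF Q(1)] by blast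
      then show ?thesis by (simp add: comb_def add.commute)
    qed
    then show ?thesis
      using fS(2)[OF comb_K'[OF cd]] S_comb[OF cd] cd
      by (simp add: bound_def L_def U_def field_simps)
  qed
  obtain v where v: "\<forall>c\<in>L. bound c \<le> v \<and> ((\<lambda>i. - c i) \<notin> Q \<longrightarrow> bound c < v)"
    "\<forall>d\<in>U. v \<le> bound d \<and> ((\<lambda>i. - d i) \<notin> Q \<longrightarrow> v < bound d)"
    using exists_between_bounds[OF fin(2,3), of bound bound "\<lambda>c. (\<lambda>i. - c i) \<notin> Q"]
      bounds strict_bounds by blast
  have sum: "(\<Sum>i\<in>insert x X. real_of_int (c i) * (f(x := v)) i) = real_of_int (c x) * v + S c" for c
    using insert.hyps by (simp add: S_def) (intro sum.cong; auto)
  have "0 \<le> real_of_int (c x) * v + S c \<and> ((\<lambda>i. - c i) \<notin> Q \<longrightarrow> 0 < real_of_int (c x) * v + S c)"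
    if c: "c \<in> K" for c
  proof -
    consider "c \<in> Z" | "c \<in> L" | "c \<in> U" using c by (force simp: Z_def L_def U_def)
    then show ?thesis
    proof cases
      case 1
      then show ?thesis using fS[of c] by (auto simp: K'_def Z_def)
    next
      case 2
      then show ?thesis using v(1) by (auto simp: bound_def L_def field_simps)
    next
      case 3
      then show ?thesis using v(2) by (auto simp: bound_def U_def field_simps)
    qed
  qed
  then show ?case by (intro exI[of _ "f(x := v)"], simp only: sum) blast
qed

lemma sum_image_mset_count:
  fixes f :: "'i \<Rightarrow> real"
  assumes "finite X" "set_mset M \<subseteq> X"
  shows "(\<Sum>i\<in>X. real (count M i) * f i) = (\<Sum>i\<in>#M. f i)"
  using assms(2)
proof (induction M)
  case empty
  then show ?case by simp
next
  case (add a M)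
  have "(\<Sum>i\<in>X. real (count (add_mset a M) i) * f i)
      = (\<Sum>i\<in>X. real (count M i) * f i + (if i = a then f i else 0))"
    by (intro sum.cong) (auto simp: algebra_simps)
  also have "\<dots> = (\<Sum>i\<in>#M. f i) + f a"
    using add assms(1) by (simp add: sum.distrib)
  finally show ?case by simp
qed

text \<open>Invariance makes \<open>R M N\<close> depend only on the difference of the multiplicity
  vectors. The differences that occur form the set \<open>Q\<close> of the previous elimination, and
  a failing comparison turns the reversed one into a strict constraint.\<close>

lemma multiset_preorder_realization:
  fixes R :: "'i multiset \<Rightarrow> 'i multiset \<Rightarrow> bool"
  assumes total: "\<And>M N. R M N \<or> R N M"
    and trans: "\<And>M N P. \<lbrakk>R M N; R N P\<rbrakk> \<Longrightarrow> R M P"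
    and cancel: "\<And>M N P. R (M + P) (N + P) \<longleftrightarrow> R M N"
    and F: "finite F"
  shows "\<exists>f :: 'i \<Rightarrow> real. \<forall>M\<in>F. \<forall>N\<in>F. R M N \<longleftrightarrow> (\<Sum>i\<in>#M. f i) \<le> (\<Sum>i\<in>#N. f i)"
proof -
  define X where "X = (\<Union>M\<in>F. set_mset M)"
  have X: "finite X" and FX: "\<And>M. M \<in> F \<Longrightarrow> set_mset M \<subseteq> X"
    using F by (auto simp: X_def)
  define diff where "diff M N = (\<lambda>i. int (count N i) - int (count M i))" for M N :: "'i multiset"
  define Q where "Q = {diff M N | M N. R M N}"
  \<comment> \<open>Equal differences mean \<open>M + N' = M' + N\<close>, so both comparisons
    become the same one after padding and cancelling.\<close>
  have Q_iff: "diff M N \<in> Q \<longleftrightarrow> R M N" for M N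
  proof
    assume "diff M N \<in> Q"
    then obtain M' N' where R: "R M' N'" and eq: "diff M N = diff M' N'" by (auto simp: Q_def)
    have "count (M + N') i = count (M' + N) i" for i
      using fun_cong[OF eq, of i] unfolding diff_def count_union by linarith
    then have "M + N' = M' + N" by (intro multiset_eqI)
    then have "R (M + N') (N + N') \<longleftrightarrow> R (M' + N) (N' + N)" by (simp add: add.commute)
    then show "R M N" using R cancel by simp
  qed (auto simp: Q_def)
  define K where "K = {diff M N | M N. M \<in> F \<and> N \<in> F \<and> R M N}"
  have "\<exists>f. \<forall>c\<in>K. 0 \<le> (\<Sum>i\<in>X. real_of_int (c i) * f i) \<and>
    ((\<lambda>i. - c i) \<notin> Q \<longrightarrow> 0 < (\<Sum>i\<in>X. real_of_int (c i) * f i))"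
  proof (rule total_preorder_realization[OF X])
    have "K \<subseteq> (\<lambda>(M, N). diff M N) ` (F \<times> F)" by (auto simp: K_def)
    then show "finite K" using F by (meson finite_SigmaI finite_imageI finite_subset)
    show "K \<subseteq> Q" by (auto simp: K_def Q_def)
    show "(\<lambda>i. c i + d i) \<in> Q" if "c \<in> Q" "d \<in> Q" for c d
    proof -
      obtain M N where 1: "R M N" "c = diff M N" using \<open>c \<in> Q\<close> by (auto simp: Q_def)
      obtain M' N' where 2: "R M' N'" "d = diff M' N'" using \<open>d \<in> Q\<close> by (auto simp: Q_def)
      have "R (M + M') (N + M')" using 1 cancel by simp
      moreover have "R (N + M') (N + N')" using 2 cancel[of M' N N'] by (simp add: add.commute)
      ultimately have "diff (M + M') (N + N') \<in> Q" using trans Q_iff by blast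
      moreover have "diff (M + M') (N + N') = (\<lambda>i. c i + d i)" by (simp add: diff_def 1 2 fun_eq_iff)
      ultimately show ?thesis by simp
    qed
    show "c \<in> Q \<or> (\<lambda>i. - c i) \<in> Q" if c: "\<And>i. i \<notin> X \<Longrightarrow> c i = 0" for c
    proof -
      \<comment> \<open>An integer vector is the difference of its positive and its negative part,
        both read as multisets; totality of \<open>R\<close> on them gives totality on
        vectors.\<close>
      define pos where "pos c = (\<Sum>j\<in>X. replicate_mset (nat (c j)) j)" for c :: "'i \<Rightarrow> int"
      have count_pos: "count (pos c) i = nat (c i)" if "i \<notin> X \<Longrightarrow> c i = 0" for c i
      proof -
        have "count (pos c) i = (\<Sum>j\<in>X. if i = j then nat (c j) else 0)"
          by (simp add: pos_def count_sum)
        also have "\<dots> = (if i \<in> X then nat (c i) else 0)" using X by (rule sum.delta')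
        finally show ?thesis using that by simp
      qed
      have "diff (pos (\<lambda>i. - c i)) (pos c) = c" "diff (pos c) (pos (\<lambda>i. - c i)) = (\<lambda>i. - c i)"
        using c by (auto simp: diff_def count_pos fun_eq_iff)
      then show ?thesis using total Q_iff by metis
    qed
    show "c i = 0" if c: "c \<in> K" and i: "i \<notin> X" for c i
    proof -
      obtain M N where "M \<in> F" "N \<in> F" "c = diff M N" using c by (auto simp: K_def)
      moreover from this have "i \<notin># M" "i \<notin># N" using FX i by blast+
      ultimately show ?thesis by (simp add: diff_def not_in_iff)
    qed
  qed
  then obtain f where f: "\<And>c. c \<in> K \<Longrightarrow> 0 \<le> (\<Sum>i\<in>X. real_of_int (c i) * f i)"
    "\<And>c. \<lbrakk>c \<in> K; (\<lambda>i. - c i) \<notin> Q\<rbrakk> \<Longrightarrow> 0 < (\<Sum>i\<in>X. real_of_int (c i) * f i)"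
    by blast
  have sum: "(\<Sum>i\<in>X. real_of_int (diff M N i) * f i) = (\<Sum>i\<in>#N. f i) - (\<Sum>i\<in>#M. f i)"
    if "M \<in> F" "N \<in> F" for M N
    using sum_image_mset_count[OF X FX[OF that(1)], of f] sum_image_mset_count[OF X FX[OF that(2)], of f]
    by (simp add: diff_def left_diff_distrib sum_subtractf)
  have "R M N \<longleftrightarrow> (\<Sum>i\<in>#M. f i) \<le> (\<Sum>i\<in>#N. f i)" if MN: "M \<in> F" "N \<in> F" for M N
  proof
    assume "R M N"
    then have "diff M N \<in> K" using MN by (auto simp: K_def)
    then show "(\<Sum>i\<in>#M. f i) \<le> (\<Sum>i\<in>#N. f i)" using f(1) sum[OF MN] by fastforce
  next
    assume le: "(\<Sum>i\<in>#M. f i) \<le> (\<Sum>i\<in>#N. f i)"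
    show "R M N"
    proof (rule ccontr)
      assume not: "\<not> R M N"
      then have "diff N M \<in> K" using total MN by (auto simp: K_def)
      moreover have "(\<lambda>i. - diff N M i) = diff M N" by (simp add: diff_def fun_eq_iff)
      ultimately have "0 < (\<Sum>i\<in>#M. f i) - (\<Sum>i\<in>#N. f i)"
        using f(2) sum[OF MN(2,1)] not Q_iff by metis
      then show False using le by simp
    qed
  qed
  then show ?thesis by blast
qed

section \<open>The line over an MV-chain\<close>

locale mv_chain = mv_algebra A for A (structure) +
  assumes hle_total: "\<lbrakk>x \<in> carrier A; y \<in> carrier A\<rbrakk> \<Longrightarrow> x \<preceq> y \<or> y \<preceq> x"
    and zero_not_one: "\<zero> \<noteq> \<one>"

context mv_algebra
begin

lemma neg_neg: "x \<in> carrier A \<Longrightarrow> (x \<leadsto> \<zero>) \<leadsto> \<zero> = x"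
  by (simp add: imp_imp_eq zero_closed zero_least)

lemma neg_mult:
  "\<lbrakk>x \<in> carrier A; y \<in> carrier A\<rbrakk> \<Longrightarrow> (x \<otimes> (y \<leadsto> \<zero>)) \<leadsto> \<zero> = x \<leadsto> y"
  using residuation[of x "y \<leadsto> \<zero>" \<zero>] by (simp add: imp_closed zero_closed neg_neg)

lemma mult_neg_eq:
  "\<lbrakk>x \<in> carrier A; y \<in> carrier A\<rbrakk> \<Longrightarrow> x \<otimes> (y \<leadsto> \<zero>) = (x \<leadsto> y) \<leadsto> \<zero>"
  using neg_neg[of "x \<otimes> (y \<leadsto> \<zero>)"] neg_mult[of x y] by (simp add: imp_closed zero_closed)

text \<open>The pair \<open>(m, x)\<close> with \<open>x \<noteq> 1\<close> stands for \<open>m + x\<close>. In the next definition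
  \<open>(a \<leadsto> \<zero>) \<leadsto> x\<close> is the truncated sum of \<open>x\<close> and \<open>a\<close>, and \<open>x \<otimes> a\<close> is what
  remains after a carry. Arguments outside the line are left alone so that shifts
  commute unconditionally.\<close>
definition line :: "(int \<times> 'a) set" where
  "line = UNIV \<times> (carrier A - {\<one>})"

definition shift :: "'a \<Rightarrow> int \<times> 'a \<Rightarrow> int \<times> 'a" where
  "shift a p = (if a \<in> carrier A \<and> p \<in> line
    then if a \<leadsto> \<zero> \<preceq> snd p then (fst p + 1, snd p \<otimes> a) else (fst p, (a \<leadsto> \<zero>) \<leadsto> snd p)
    else p)"

definition line_le :: "int \<times> 'a \<Rightarrow> int \<times> 'a \<Rightarrow> bool" where
  "line_le p q \<longleftrightarrow> fst p < fst q \<or> fst p = fst q \<and> snd p \<preceq> snd q"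

lemma mult_ne_one:
  assumes "x \<in> carrier A" "a \<in> carrier A" "x \<noteq> \<one>"
  shows "x \<otimes> a \<noteq> \<one>"
  using mult_hle_left[of x a] one_imp assms by metis

lemma shift_line: "p \<in> line \<Longrightarrow> shift a p \<in> line"
  by (auto simp: shift_def line_def imp_closed zero_closed mult_ne_one)

end

section \<open>Shifts of the line commute, preserve and reflect the order\<close>

context mv_chain
begin

text \<open>Both sides stand for the same sum of three terms. The test
  \<open>a \<leadsto> \<zero> \<preceq> x\<close> asks whether \<open>a\<close> and \<open>x\<close>
  add up to at least 1, and the cases record which of \<open>a\<close> and \<open>b\<close> carries
  when added to \<open>x\<close> alone.\<close>

lemma shift_commute: "shift a (shift b p) = shift b (shift a p)"
proof (cases "a \<in> carrier A \<and> b \<in> carrier A \<and> p \<in> line")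
  case False
  then show ?thesis using shift_line by (auto simp: shift_def)
next
  case True
  then obtain m x where p: "p = (m, x)" and a: "a \<in> carrier A" and b: "b \<in> carrier A"
    and x: "x \<in> carrier A" "x \<noteq> \<one>" by (auto simp: line_def)
  \<comment> \<open>If only \<open>b\<close> carries on \<open>x\<close>, there is exactly one carry
    in either order. It remains to see that removing 1 before or after adding \<open>a\<close> gives
    the same element, which is \<open>eq\<close> below.\<close>
  have carry_first: "shift a (shift b (m, x)) = shift b (shift a (m, x))"
    if a: "a \<in> carrier A" and b: "b \<in> carrier A"
      and px: "\<not> a \<leadsto> \<zero> \<preceq> x" and qx: "b \<leadsto> \<zero> \<preceq> x" for a b
  proof -
    let ?p = "a \<leadsto> \<zero>" and ?q = "b \<leadsto> \<zero>"
    have pq: "?p \<in> carrier A" "?q \<in> carrier A" using a b by (simp_all add: imp_closed zero_closed)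
    have xp: "x \<preceq> ?p" using hle_total[OF pq(1) x(1)] px by simp
    have "?q \<preceq> ?p \<leadsto> x"
      using hle_trans[of ?q x "?p \<leadsto> x"] hle_imp[of ?p x] qx pq x by (simp add: imp_closed)
    have "(?p \<leadsto> x) \<leadsto> ?q \<preceq> (?p \<leadsto> x) \<leadsto> x"
      using imp_mono_hle[OF _ _ _ qx, of "?p \<leadsto> x"] pq x by (simp add: imp_closed)
    then have le: "(?p \<leadsto> x) \<leadsto> ?q \<preceq> ?p"
      using imp_imp_eq[OF pq(1) x(1) xp] by simp
    have "x \<leadsto> ?q = ?p \<leadsto> ((?p \<leadsto> x) \<leadsto> ?q)"
      using residuation[of ?p "?p \<leadsto> x" ?q] mult_imp_eq[OF pq(1) x(1) xp] pq x
      by (simp add: imp_closed)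
    then have "?p \<otimes> (x \<leadsto> ?q) = (?p \<leadsto> x) \<leadsto> ?q"
      using mult_imp_eq[OF pq(1) _ le] pq x by (simp add: imp_closed)
    moreover have "?p \<leadsto> ((x \<leadsto> ?q) \<leadsto> \<zero>) = (?p \<otimes> (x \<leadsto> ?q)) \<leadsto> \<zero>"
      using residuation[of ?p "x \<leadsto> ?q" \<zero>] pq x by (simp add: imp_closed zero_closed)
    moreover have "x \<otimes> b = (x \<leadsto> ?q) \<leadsto> \<zero>" "(?p \<leadsto> x) \<otimes> b = ((?p \<leadsto> x) \<leadsto> ?q) \<leadsto> \<zero>"
      using mult_neg_eq[of x ?q] mult_neg_eq[of "?p \<leadsto> x" ?q] b x pq
      by (simp_all add: neg_neg imp_closed)
    ultimately have eq: "?p \<leadsto> (x \<otimes> b) = (?p \<leadsto> x) \<otimes> b" by simp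
    have "(?p \<leadsto> x) \<otimes> b \<noteq> \<one>" using mult_ne_one px pq x b by (simp add: imp_closed)
    then show ?thesis
      using a b x px qx eq \<open>?q \<preceq> ?p \<leadsto> x\<close> pq
      by (simp add: shift_def line_def mult_ne_one imp_closed)
  qed
  let ?p = "a \<leadsto> \<zero>" and ?q = "b \<leadsto> \<zero>"
  have pq: "?p \<in> carrier A" "?q \<in> carrier A" using a b by (simp_all add: imp_closed zero_closed)
  consider "\<not> ?p \<preceq> x" "\<not> ?q \<preceq> x" | "\<not> ?p \<preceq> x" "?q \<preceq> x" | "?p \<preceq> x" "\<not> ?q \<preceq> x"
    | "?p \<preceq> x" "?q \<preceq> x" by blast
  then show ?thesis
  proof cases
    case 1
    \<comment> \<open>Neither addition carries at first. The computation shows that the remainders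
      agree in case the second addition carries.\<close>
    then have le: "x \<preceq> ?p" "x \<preceq> ?q" using hle_total pq x by blast+
    have "(?p \<leadsto> x) \<leadsto> ?q = (?p \<leadsto> x) \<leadsto> ((?q \<leadsto> x) \<leadsto> x)"
      using imp_imp_eq[OF pq(2) x(1) le(2)] by simp
    also have "\<dots> = (?q \<leadsto> x) \<leadsto> ((?p \<leadsto> x) \<leadsto> x)"
      using exchange[of "?p \<leadsto> x" "?q \<leadsto> x" x] pq x by (simp add: imp_closed)
    also have "\<dots> = (?q \<leadsto> x) \<leadsto> ?p" using imp_imp_eq[OF pq(1) x(1) le(1)] by simp
    finally have "((?p \<leadsto> x) \<leadsto> ?q) \<leadsto> \<zero> = ((?q \<leadsto> x) \<leadsto> ?p) \<leadsto> \<zero>" by simp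
    then have "(?p \<leadsto> x) \<otimes> b = (?q \<leadsto> x) \<otimes> a"
      using mult_neg_eq[of "?p \<leadsto> x" ?q] mult_neg_eq[of "?q \<leadsto> x" ?p] pq x a b
      by (simp add: neg_neg imp_closed)
    \<comment> \<open>This single equation compares the carry tests of the second addition as well
      as its results without carry, since the test is equality of these terms with
      \<open>\<one>\<close>.\<close>
    moreover have "?p \<leadsto> (?q \<leadsto> x) = ?q \<leadsto> (?p \<leadsto> x)" using exchange pq x by simp
    ultimately show ?thesis
      using 1 a b x pq by (simp add: p shift_def line_def imp_closed)
  next
    case 2
    then show ?thesis using carry_first a b p by simp
  next
    case 3
    then show ?thesis using carry_first[of b a] a b p by simp
  next
    case 4
    \<comment> \<open>Both first additions carry. The aim is an equation that again decides the
      second carry test and gives the uncarried result; its two sides come from the two ways of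
      writing the meet of \<open>x\<close> with a negation.\<close>
    have "?q \<otimes> (x \<leadsto> ?p) = x \<otimes> (x \<leadsto> ?q) \<otimes> (x \<leadsto> ?p)"
      using mult_imp_eq[OF x(1) pq(2) 4(2)] by simp
    also have "\<dots> = x \<otimes> (x \<leadsto> ?p) \<otimes> (x \<leadsto> ?q)"
      using pq x by (simp add: m_ac imp_closed)
    also have "\<dots> = ?p \<otimes> (x \<leadsto> ?q)" using mult_imp_eq[OF x(1) pq(1) 4(1)] by simp
    finally have "?q \<leadsto> ((x \<leadsto> ?p) \<leadsto> \<zero>) = ?p \<leadsto> ((x \<leadsto> ?q) \<leadsto> \<zero>)"
      using residuation[of ?q "x \<leadsto> ?p" \<zero>] residuation[of ?p "x \<leadsto> ?q" \<zero>] pq x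
      by (simp add: imp_closed zero_closed)
    then have "?q \<leadsto> (x \<otimes> a) = ?p \<leadsto> (x \<otimes> b)"
      using mult_neg_eq[of x ?p] mult_neg_eq[of x ?q] pq x a b by (simp add: neg_neg)
    moreover have "x \<otimes> a \<otimes> b = x \<otimes> b \<otimes> a" using x a b by (simp add: m_ac)
    ultimately show ?thesis
      using 4 a b x pq by (simp add: p shift_def line_def mult_ne_one)
  qed
qed

lemma line_le_total: "\<lbrakk>p \<in> line; q \<in> line\<rbrakk> \<Longrightarrow> line_le p q \<or> line_le q p"
  using hle_total[of "snd p" "snd q"] by (auto simp: line_def line_le_def)

lemma line_le_trans:
  "\<lbrakk>p \<in> line; q \<in> line; r \<in> line; line_le p q; line_le q r\<rbrakk> \<Longrightarrow> line_le p r"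
  using hle_trans[of "snd p" "snd q" "snd r"] by (auto simp: line_def line_le_def)

lemma shift_mono:
  assumes p: "p \<in> line" and q: "q \<in> line" and le: "line_le p q"
  shows "line_le (shift a p) (shift a q)"
proof (cases "a \<in> carrier A")
  case False
  then show ?thesis using le by (simp add: shift_def)
next
  case a: True
  obtain m x k y where pq: "p = (m, x)" "q = (k, y)" by fastforce
  let ?c = "a \<leadsto> \<zero>"
  have x: "x \<in> carrier A" and y: "y \<in> carrier A" and c: "?c \<in> carrier A"
    using p q a by (auto simp: pq line_def imp_closed zero_closed)
  \<comment> \<open>A remainder after a carry is at most \<open>a\<close>, and an uncarried sum is
    at least \<open>a\<close>. Hence a carry from level \<open>m\<close> to \<open>m + 1\<close>
    cannot overtake an uncarried point there.\<close>
  have "a \<preceq> ?c \<leadsto> y"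
    using imp_mono_hle[of ?c \<zero> y] a y c by (simp add: zero_closed zero_least neg_neg)
  then have carry: "x \<otimes> a \<preceq> ?c \<leadsto> y"
    using hle_trans[of "x \<otimes> a" a "?c \<leadsto> y"] mult_hle_right a x y c by (simp add: imp_closed)
  consider "m < k" | "m = k" "x \<preceq> y" using le by (auto simp: pq line_le_def)
  then show ?thesis
  proof cases
    case 1
    then show ?thesis using carry p q by (auto simp: pq shift_def line_le_def)
  next
    case 2
    have "x \<otimes> a \<preceq> y \<otimes> a" "?c \<leadsto> x \<preceq> ?c \<leadsto> y"
      using 2 a x y c by (simp_all add: mult_mono_hle imp_mono_hle)
    moreover have "?c \<preceq> y" if "?c \<preceq> x" using hle_trans[OF c x y that 2(2)] .
    ultimately show ?thesis using 2 p q by (auto simp: pq shift_def line_le_def)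
  qed
qed

text \<open>Reflection of the order is the half of cancellation that monotonicity does not give. It
  depends on the element \<open>\<one>\<close> being excluded from the line.\<close>

lemma shift_strict_mono:
  assumes p: "p \<in> line" and q: "q \<in> line" and not_le: "\<not> line_le p q"
  shows "\<not> line_le (shift a p) (shift a q)"
proof (cases "a \<in> carrier A")
  case False
  then show ?thesis using not_le by (simp add: shift_def)
next
  case a: True
  obtain m x k y where pq: "p = (m, x)" "q = (k, y)" by fastforce
  let ?c = "a \<leadsto> \<zero>"
  have x: "x \<in> carrier A" and y: "y \<in> carrier A" "y \<noteq> \<one>" and c: "?c \<in> carrier A"
    using p q a by (auto simp: pq line_def imp_closed zero_closed)
  have neg_mult_a: "(z \<otimes> a) \<leadsto> \<zero> = z \<leadsto> ?c" if "z \<in> carrier A" for z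
    using residuation[of z a \<zero>] that a by (simp add: zero_closed)
  consider "k < m" | "m = k" "\<not> x \<preceq> y"
    using not_le by (cases m k rule: linorder_cases) (auto simp: pq line_le_def)
  then show ?thesis
  proof cases
    case 1
    \<comment> \<open>The critical case: the lower point \<open>q\<close> carries up to the level of
      \<open>p\<close> while \<open>p\<close> does not carry. If it caught up, \<open>a\<close>
      would lie below \<open>y \<otimes> a\<close>, which forces \<open>y = \<one>\<close>.\<close>
    have "\<not> ?c \<leadsto> x \<preceq> y \<otimes> a" if cy: "?c \<preceq> y"
    proof
      assume le: "?c \<leadsto> x \<preceq> y \<otimes> a"
      have "a \<preceq> ?c \<leadsto> x"
        using imp_mono_hle[of ?c \<zero> x] a x c by (simp add: zero_closed zero_least neg_neg)
      then have "a \<preceq> y \<otimes> a"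
        using hle_trans[OF a _ _ _ le] a x y c by (simp add: imp_closed)
      then have "y \<leadsto> ?c \<preceq> ?c"
        using imp_antimono_hle[of a "y \<otimes> a" \<zero>] neg_mult_a a y by (simp add: zero_closed)
      then show False using imp_imp_eq[OF y(1) c cy] y by simp
    qed
    then show ?thesis using 1 p q a by (auto simp: pq shift_def line_le_def)
  next
    case 2
    have yx: "y \<preceq> x" using hle_total x y 2 by blast
    \<comment> \<open>Above \<open>?c\<close> the factor \<open>a\<close> can be cancelled: the
      negation of \<open>x \<otimes> a\<close> is \<open>x \<leadsto> ?c\<close>, and a second
      implication into \<open>?c\<close> recovers \<open>x\<close>.\<close>
    have "\<not> x \<otimes> a \<preceq> y \<otimes> a" if cx: "?c \<preceq> x" and cy: "?c \<preceq> y"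
    proof
      assume "x \<otimes> a \<preceq> y \<otimes> a"
      then have "y \<leadsto> ?c \<preceq> x \<leadsto> ?c"
        using imp_antimono_hle[of "x \<otimes> a" "y \<otimes> a" \<zero>] neg_mult_a a x y by (simp add: zero_closed)
      then have "(x \<leadsto> ?c) \<leadsto> ?c \<preceq> (y \<leadsto> ?c) \<leadsto> ?c"
        using imp_antimono_hle x y c by (simp add: imp_closed)
      then show False using 2 x y c cx cy by (simp add: imp_imp_eq)
    qed
    moreover have "\<not> ?c \<leadsto> x \<preceq> ?c \<leadsto> y" if ncx: "\<not> ?c \<preceq> x" and ncy: "\<not> ?c \<preceq> y"
    proof
      assume "?c \<leadsto> x \<preceq> ?c \<leadsto> y"
      then have "?c \<otimes> (?c \<leadsto> x) \<preceq> ?c \<otimes> (?c \<leadsto> y)"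
        using x y c by (simp add: mult_mono2_hle imp_refl imp_closed)
      moreover have "x \<preceq> ?c" "y \<preceq> ?c" using hle_total x y c ncx ncy by blast+
      ultimately show False using 2 x y c by (simp add: mult_imp_eq)
    qed
    moreover have "?c \<preceq> x" if "?c \<preceq> y" using hle_trans[OF c y(1) x that yx] .
    ultimately show ?thesis using 2 p q a by (auto simp: pq shift_def line_le_def)
  qed
qed

section \<open>Sums on the line and the preorder on multisets\<close>

sublocale shift: comp_fun_commute shift
  by standard (simp add: shift_commute fun_eq_iff)

text \<open>Independent of the order of summation because shifts commute. It replaces the sum in
  Chang's group.\<close>

definition line_sum :: "'a multiset \<Rightarrow> int \<times> 'a" where
  "line_sum M = fold_mset shift (0, \<zero>) M"

definition mset_le :: "'a multiset \<Rightarrow> 'a multiset \<Rightarrow> bool" where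
  "mset_le M N \<longleftrightarrow> line_le (line_sum M) (line_sum N)"

lemma line_sum_empty: "line_sum {#} = (0, \<zero>)"
  by (simp add: line_sum_def)

lemma line_sum_add_mset: "line_sum (add_mset a M) = shift a (line_sum M)"
  by (simp add: line_sum_def)

lemma line_sum_line: "line_sum M \<in> line"
proof (induction M)
  case empty
  then show ?case using zero_closed zero_not_one by (simp add: line_sum_empty line_def)
next
  case (add a M)
  then show ?case by (simp add: line_sum_add_mset shift_line)
qed

lemma mset_le_add_cancel: "mset_le (M + P) (N + P) \<longleftrightarrow> mset_le M N"
proof (induction P)
  case (add a P)
  have "mset_le (M + add_mset a P) (N + add_mset a P) \<longleftrightarrow> mset_le (M + P) (N + P)"
    using shift_mono shift_strict_mono line_sum_line
    by (simp only: mset_le_def line_sum_add_mset union_mset_add_mset_right) blast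
  then show ?case using add by simp
qed simp

lemma mset_le_total: "mset_le M N \<or> mset_le N M"
  using line_le_total line_sum_line by (simp add: mset_le_def)

lemma mset_le_trans: "\<lbrakk>mset_le M N; mset_le N P\<rbrakk> \<Longrightarrow> mset_le M P"
  using line_le_trans line_sum_line unfolding mset_le_def by blast

lemma mset_le_realization:
  assumes "finite F"
  shows "\<exists>f :: 'a \<Rightarrow> real. \<forall>M\<in>F. \<forall>N\<in>F.
    mset_le M N \<longleftrightarrow> (\<Sum>i\<in>#M. f i) \<le> (\<Sum>i\<in>#N. f i)"
  using assms mset_le_total mset_le_trans mset_le_add_cancel
  by (intro multiset_preorder_realization)

text \<open>The element \<open>\<one>\<close> is no second coordinate on the line: added to
  \<open>\<zero>\<close> it carries and becomes the integer 1.\<close>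

lemma line_sum_single:
  assumes "x \<in> carrier A"
  shows "line_sum {#x#} = (if x = \<one> then (1, \<zero>) else (0, x))"
  using assms zero_closed zero_not_one
  by (simp add: line_sum_add_mset line_sum_empty shift_def line_def neg_neg)

lemma shift_one: "p \<in> line \<Longrightarrow> shift \<one> p = (fst p + 1, snd p)"
  by (auto simp: shift_def line_def one_imp zero_closed zero_least)

lemma mset_le_single:
  assumes "x \<in> carrier A" "y \<in> carrier A"
  shows "mset_le {#x#} {#y#} \<longleftrightarrow> x \<preceq> y"
  using assms one_imp by (auto simp: mset_le_def line_le_def line_sum_single imp_one imp_refl zero_closed)

text \<open>The additive form of x \<rightarrow> y = 1 - x + y. Adding \<open>x \<leadsto> y\<close>
  to \<open>x\<close> carries, because the negation of \<open>x \<leadsto> y\<close> is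
  \<open>x \<otimes> (y \<leadsto> \<zero>)\<close>, and the remainder is \<open>y\<close> by
  divisibility.\<close>

lemma line_sum_imp:
  assumes x: "x \<in> carrier A" and y: "y \<in> carrier A" and le: "y \<preceq> x"
  shows "line_sum {#x \<leadsto> y, x#} = line_sum {#\<one>, y#}"
proof (cases "x = \<one>")
  case True
  then show ?thesis using y by (simp add: one_imp add_mset_commute)
next
  case False
  then have "y \<noteq> \<one>" using le one_imp x by auto
  have "(x \<leadsto> y) \<leadsto> \<zero> \<preceq> x"
    using mult_neg_eq[OF x y] mult_hle_left[of x "y \<leadsto> \<zero>"] x y by (simp add: imp_closed zero_closed)
  then show ?thesis
    using False \<open>y \<noteq> \<one>\<close> x y le line_sum_line[of "{#y#}"] mult_imp_eq[OF x y le]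
    by (simp add: line_sum_add_mset[of _ "{#_#}"] line_sum_single shift_one)
      (simp add: shift_def line_def imp_closed)
qed

text \<open>The two alternatives are the branches of \<open>max 0 (x + y - 1)\<close>: a carry
  leaves exactly the product as remainder, and without a carry the product has been truncated to
  \<open>\<zero>\<close>.\<close>

lemma line_sum_mult:
  assumes x: "x \<in> carrier A" and y: "y \<in> carrier A"
  shows "line_sum {#x, y#} = line_sum {#\<one>, x \<otimes> y#} \<or>
    x \<otimes> y = \<zero> \<and> mset_le {#x, y#} {#\<one>, \<zero>#}"
proof (cases "x = \<one> \<or> y = \<one>")
  case True
  then show ?thesis using x y by (auto simp: add_mset_commute)
next
  case False
  have yx: "{#x, y#} = add_mset y {#x#}" by (simp add: add_mset_commute)
  have ne: "x \<otimes> y \<noteq> \<one>" using False x y mult_ne_one by blast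
  show ?thesis
  proof (cases "y \<leadsto> \<zero> \<preceq> x")
    case True
    then show ?thesis
      using False ne x y line_sum_line[of "{#x \<otimes> y#}"]
      by (simp add: yx line_sum_add_mset[of _ "{#_#}"] line_sum_single shift_one)
        (simp add: shift_def line_def)
  next
    case nle: False
    then have "x \<preceq> y \<leadsto> \<zero>" using hle_total x y by (blast intro: imp_closed zero_closed)
    then have "x \<otimes> y \<preceq> \<zero>" using residuation[of x y \<zero>] x y by (simp add: zero_closed)
    then have "x \<otimes> y = \<zero>" using hle_antisym x y zero_closed zero_least by simp
    moreover have "mset_le {#x, y#} {#\<one>, \<zero>#}"
      using nle False x y line_sum_line[of "{#\<zero>#}"] zero_closed zero_not_one
      by (simp add: mset_le_def line_le_def yx line_sum_add_mset[of _ "{#_#}"] line_sum_single shift_one)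
        (simp add: shift_def line_def)
    ultimately show ?thesis by simp
  qed
qed

section \<open>Finite partial embeddings into the standard algebra\<close>

definition partial_embedding :: "'a set \<Rightarrow> ('a \<Rightarrow> real) \<Rightarrow> bool" where
  "partial_embedding X r \<longleftrightarrow> r \<one> = 1 \<and>
    (\<forall>x\<in>X. 0 \<le> r x \<and> r x \<le> 1) \<and>
    (\<forall>x\<in>X. \<forall>y\<in>X. (x \<preceq> y \<longleftrightarrow> r x \<le> r y) \<and>
      r (x \<otimes> y) = max 0 (r x + r y - 1) \<and> r (x \<leadsto> y) = min 1 (1 - r x + r y))"

text \<open>Every clause of \<open>partial_embedding\<close> is an equation or inequality between
  sums of two elements, possibly padded by \<open>\<zero>\<close> or \<open>\<one>\<close>.
  Realizing the preorder on two-element multisets therefore suffices, and such relations survive a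
  positive affine rescaling.\<close>

lemma exists_partial_embedding:
  assumes X: "finite X" "X \<subseteq> carrier A"
  shows "\<exists>r. partial_embedding X r"
proof -
  \<comment> \<open>The clauses for the operations mention \<open>r\<close> at results that may lie
    outside \<open>X\<close>, so these are added together with both constants.\<close>
  define Y where "Y = {\<zero>, \<one>} \<union> X \<union> (\<lambda>(x, y). x \<otimes> y) ` (X \<times> X) \<union> (\<lambda>(x, y). x \<leadsto> y) ` (X \<times> X)"
  have Y: "finite Y" "X \<subseteq> Y" "\<zero> \<in> Y" "\<one> \<in> Y"
    using X by (auto simp: Y_def)
  have YX: "x \<otimes> y \<in> Y" "x \<leadsto> y \<in> Y" if "x \<in> X" "y \<in> X" for x y
    using that by (auto simp: Y_def)
  have "finite ((\<lambda>(x, y). {#x, y#}) ` (Y \<times> Y))" using Y(1) by simp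
  from mset_le_realization[OF this] obtain f :: "'a \<Rightarrow> real" where
    f: "mset_le {#x, y#} {#z, w#} \<longleftrightarrow> f x + f y \<le> f z + f w"
    if "x \<in> Y" "y \<in> Y" "z \<in> Y" "w \<in> Y" for x y z w
    by auto
  have f_eq: "f x + f y = f z + f w"
    if "line_sum {#x, y#} = line_sum {#z, w#}" "x \<in> Y" "y \<in> Y" "z \<in> Y" "w \<in> Y" for x y z w
    using f[of x y z w] f[of z w x y] that mset_le_total[of "{#x, y#}" "{#z, w#}"]
    by (simp add: mset_le_def)
  have YA: "x \<in> carrier A" if "x \<in> Y" for x
    using that X(2) by (auto simp: Y_def zero_closed intro!: imp_closed m_closed dest: subsetD)
  \<comment> \<open>Single elements are compared through pairs, by adding \<open>\<zero>\<close> to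
    both.\<close>
  have f_le: "x \<preceq> y \<longleftrightarrow> f x \<le> f y" if "x \<in> Y" "y \<in> Y" for x y
    using f[of x \<zero> y \<zero>] mset_le_add_cancel[of "{#x#}" "{#\<zero>#}" "{#y#}"] mset_le_single Y(3) that YA
    by (simp add: add_mset_commute)
  define d where "d = f \<one> - f \<zero>"
  have d: "d > 0"
    using f_le[OF Y(4,3)] zero_not_one one_imp[OF zero_closed] by (simp add: d_def)
  \<comment> \<open>Comparing pairs only does not determine \<open>f \<zero>\<close>; subtracting it
    and dividing by \<open>d\<close> sends the constants to 0 and 1.\<close>
  define r where "r x = (f x - f \<zero>) / d" for x
  have r_le: "x \<preceq> y \<longleftrightarrow> r x \<le> r y" if "x \<in> Y" "y \<in> Y" for x y
    using f_le[OF that] d by (simp add: r_def divide_le_cancel)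
  have r01: "r \<zero> = 0" "r \<one> = 1" using d by (simp_all add: r_def d_def)
  have r_add: "r x + r y = r z + r w" if "f x + f y = f z + f w" for x y z w
    using that by (simp add: r_def flip: add_divide_distrib)
  have r_add_le: "r x + r y \<le> r z + r w" if "f x + f y \<le> f z + f w" for x y z w
    using that d by (simp add: r_def divide_right_mono flip: add_divide_distrib)
  have bounds: "0 \<le> r x \<and> r x \<le> 1" if "x \<in> Y" for x
    using r_le[of \<zero> x] r_le[of x \<one>] that Y YA by (simp add: r01 zero_least imp_one)
  have r_imp: "r (x \<leadsto> y) = min 1 (1 - r x + r y)" if xy: "x \<in> X" "y \<in> X" for x y
  proof -
    have Yxy: "x \<in> Y" "y \<in> Y" using xy Y by auto
    show ?thesis
    proof (cases "x \<preceq> y")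
      case True
      then show ?thesis using r_le[OF Yxy] by (simp add: r01)
    next
      case False
      then have "y \<preceq> x" using hle_total YA Yxy by blast
      then have "r (x \<leadsto> y) + r x = r \<one> + r y"
        using f_eq[OF line_sum_imp[of x y]] YX[OF xy] Yxy Y YA by (intro r_add) blast
      then show ?thesis using bounds[OF YX(2)[OF xy]] by (simp add: r01)
    qed
  qed
  have r_mult: "r (x \<otimes> y) = max 0 (r x + r y - 1)" if xy: "x \<in> X" "y \<in> X" for x y
  proof -
    have Yxy: "x \<in> Y" "y \<in> Y" using xy Y by auto
    from line_sum_mult[OF YA[OF Yxy(1)] YA[OF Yxy(2)]] show ?thesis
    proof
      assume "line_sum {#x, y#} = line_sum {#\<one>, x \<otimes> y#}"
      then have "r x + r y = r \<one> + r (x \<otimes> y)"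
        using f_eq YX[OF xy] Yxy Y by (intro r_add) blast
      then show ?thesis using bounds[OF YX(1)[OF xy]] by (simp add: r01)
    next
      assume "x \<otimes> y = \<zero> \<and> mset_le {#x, y#} {#\<one>, \<zero>#}"
      then have "x \<otimes> y = \<zero>" "r x + r y \<le> r \<one> + r \<zero>"
        using f[OF Yxy Y(4,3)] r_add_le by simp_all
      then show ?thesis by (simp add: r01)
    qed
  qed
  have "partial_embedding X r"
    unfolding partial_embedding_def using r01 bounds r_le r_imp r_mult Y(2) by blast
  then show ?thesis by blast
qed

lemma partial_embedding_subset: "\<lbrakk>partial_embedding Y r; X \<subseteq> Y\<rbrakk> \<Longrightarrow> partial_embedding X r"
  unfolding partial_embedding_def by blast

text \<open>\<open>X\<close> gathers the arguments of all operations met while evaluating the term,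
  so that \<open>r\<close> commutes with each of them.\<close>

lemma exists_eval_embedding:
  assumes "\<And>v. v \<in> vars t \<Longrightarrow> e v \<in> carrier A"
  shows "\<exists>X. finite X \<and> X \<subseteq> carrier A \<and>
    (\<forall>r. partial_embedding X r \<longrightarrow> eval standard_hoop (\<lambda>v. r (e v)) t = r (eval A e t))"
proof -
  define E where "E X s \<longleftrightarrow> finite X \<and> X \<subseteq> carrier A \<and> (\<forall>r. partial_embedding X r \<longrightarrow>
    eval standard_hoop (\<lambda>v. r (e v)) s = r (eval A e s))" for X s
  have bin: "\<exists>X. E X (f s t)"
    if s: "\<exists>X. E X s" and t: "\<exists>X. E X t" and cl: "eval A e s \<in> carrier A" "eval A e t \<in> carrier A"
      and step: "\<And>r. \<lbrakk>partial_embedding {eval A e s, eval A e t} r;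
        eval standard_hoop (\<lambda>v. r (e v)) s = r (eval A e s);
        eval standard_hoop (\<lambda>v. r (e v)) t = r (eval A e t)\<rbrakk>
        \<Longrightarrow> eval standard_hoop (\<lambda>v. r (e v)) (f s t) = r (eval A e (f s t))"
    for s t f
  proof -
    obtain X Y where X: "E X s" and Y: "E Y t" using s t by blast
    have "E (X \<union> Y \<union> {eval A e s, eval A e t}) (f s t)"
      unfolding E_def
    proof (intro conjI allI impI)
      fix r assume r: "partial_embedding (X \<union> Y \<union> {eval A e s, eval A e t}) r"
      show "eval standard_hoop (\<lambda>v. r (e v)) (f s t) = r (eval A e (f s t))"
      proof (rule step)
        show "partial_embedding {eval A e s, eval A e t} r"
          using r by (rule partial_embedding_subset) blast
        have "partial_embedding X r" "partial_embedding Y r"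
          using r by (auto intro: partial_embedding_subset)
        then show "eval standard_hoop (\<lambda>v. r (e v)) s = r (eval A e s)"
          "eval standard_hoop (\<lambda>v. r (e v)) t = r (eval A e t)"
          using X Y by (simp_all add: E_def)
      qed
    qed (use X Y cl in \<open>auto simp: E_def\<close>)
    then show ?thesis by blast
  qed
  \<comment> \<open>In a chain the meet and the join are one of the two arguments, so preserving the
    order is enough for them.\<close>
  have chain_meet: "r (x \<otimes> (x \<leadsto> y)) = min (r x) (r y)"
    and chain_join: "r ((x \<leadsto> y) \<leadsto> y) = max (r x) (r y)"
    if "partial_embedding {x, y} r" "x \<in> carrier A" "y \<in> carrier A" for r x y
    using that hle_total[of x y]
    by (auto simp: partial_embedding_def min_def max_def mult_imp_eq imp_imp_eq one_imp)
  have "\<exists>X. E X t" using assms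
  proof (induction t)
    case (Var v)
    then show ?case by (intro exI[of _ "{}"]) (simp add: E_def)
  next
    case One
    then show ?case
      by (intro exI[of _ "{}"]) (simp add: E_def partial_embedding_def standard_hoop_def)
  next
    case (Times s t)
    then have cl: "eval A e s \<in> carrier A" "eval A e t \<in> carrier A" by (auto intro: eval_closed)
    have "\<exists>X. E X s" "\<exists>X. E X t" using Times by auto
    then show ?case
      by (rule bin[OF _ _ cl]) (simp add: partial_embedding_def standard_hoop_def)
  next
    case (Imp s t)
    then have cl: "eval A e s \<in> carrier A" "eval A e t \<in> carrier A" by (auto intro: eval_closed)
    have "\<exists>X. E X s" "\<exists>X. E X t" using Imp by auto
    then show ?case
      by (rule bin[OF _ _ cl]) (simp add: partial_embedding_def standard_hoop_def)
  next
    case (Meet s t)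
    then have cl: "eval A e s \<in> carrier A" "eval A e t \<in> carrier A" by (auto intro: eval_closed)
    have "\<exists>X. E X s" "\<exists>X. E X t" using Meet by auto
    then show ?case
      by (rule bin[OF _ _ cl]) (simp add: chain_meet cl meet_eq standard_hoop_def)
  next
    case (Join s t)
    then have cl: "eval A e s \<in> carrier A" "eval A e t \<in> carrier A" by (auto intro: eval_closed)
    have "\<exists>X. E X s" "\<exists>X. E X t" using Join by auto
    then show ?case
      by (rule bin[OF _ _ cl]) (simp add: chain_join cl join_eq standard_hoop_def)
  qed
  then show ?thesis by (simp add: E_def)
qed

lemma quasi_holds_chain:
  assumes t: "vars t \<subseteq> {..<n}" and u: "vars u \<subseteq> {..<n}"
    and std: "quasi_holds standard_hoop n t u"
  shows "quasi_holds A n t u"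
proof (rule quasi_holdsI[OF t u])
  fix e assume e: "\<And>i. i < n \<Longrightarrow> e i \<in> carrier A" and et: "eval A e t = \<one>"
  have eA: "e i \<in> carrier A" if "i \<in> vars t \<union> vars u" for i using that e t u by blast
  obtain X where X: "finite X" "X \<subseteq> carrier A" "\<And>r. partial_embedding X r \<Longrightarrow>
      eval standard_hoop (\<lambda>v. r (e v)) t = r (eval A e t)"
    using exists_eval_embedding[of t e] eA by blast
  obtain Y where Y: "finite Y" "Y \<subseteq> carrier A" "\<And>r. partial_embedding Y r \<Longrightarrow>
      eval standard_hoop (\<lambda>v. r (e v)) u = r (eval A e u)"
    using exists_eval_embedding[of u e] eA by blast
  have uA: "eval A e u \<in> carrier A" using eA by (simp add: eval_closed)
  \<comment> \<open>The values of \<open>e\<close> are included to make their images land in [0,1];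
    the value of \<open>u\<close> and \<open>\<one>\<close> are included so that the order
    comparison between them can be read back from the reals.\<close>
  define Z where "Z = X \<union> Y \<union> {eval A e u, \<one>} \<union> e ` {..<n}"
  have Z: "finite Z" "Z \<subseteq> carrier A" using X Y uA e by (auto simp: Z_def)
  obtain r where r: "partial_embedding Z r" using exists_partial_embedding[OF Z] by blast
  have "partial_embedding X r" "partial_embedding Y r"
    using r by (auto simp: Z_def intro: partial_embedding_subset)
  then have eval: "eval standard_hoop (\<lambda>v. r (e v)) t = r (eval A e t)"
    "eval standard_hoop (\<lambda>v. r (e v)) u = r (eval A e u)" using X Y by blast+
  have r1: "r \<one> = 1" using r by (simp add: partial_embedding_def)
  have "r (e i) \<in> carrier standard_hoop" if "i < n" for i
    using r that by (auto simp: partial_embedding_def Z_def standard_hoop_def)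
  moreover have "eval standard_hoop (\<lambda>v. r (e v)) t = \<one>\<^bsub>standard_hoop\<^esub>"
    using eval(1) r1 by (simp add: et standard_hoop_def)
  ultimately have "eval standard_hoop (\<lambda>v. r (e v)) u = \<one>\<^bsub>standard_hoop\<^esub>"
    by (rule quasi_holdsD[OF std t u])
  then have "r (eval A e u) = 1" using eval(2) by (simp add: standard_hoop_def)
  moreover have "\<one> \<preceq> eval A e u \<longleftrightarrow> r \<one> \<le> r (eval A e u)"
    using r by (simp add: partial_embedding_def Z_def)
  ultimately show "eval A e u = \<one>" using uA r1 by (simp add: one_imp)
qed

end

section \<open>Prime filters\<close>

context wajsberg_hoop
begin

text \<open>Implicative filters, given by modus ponens; closure upward and under products is
  derived.\<close>

definition hoop_filter :: "'a set \<Rightarrow> bool" where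
  "hoop_filter F \<longleftrightarrow> F \<subseteq> carrier A \<and> \<one> \<in> F \<and>
    (\<forall>x\<in>carrier A. \<forall>y\<in>carrier A. x \<in> F \<longrightarrow> x \<leadsto> y \<in> F \<longrightarrow> y \<in> F)"

lemma filter_carrier: "\<lbrakk>hoop_filter F; x \<in> F\<rbrakk> \<Longrightarrow> x \<in> carrier A"
  by (auto simp: hoop_filter_def)

lemma filter_one: "hoop_filter F \<Longrightarrow> \<one> \<in> F"
  by (simp add: hoop_filter_def)

lemma filter_mp: "\<lbrakk>hoop_filter F; x \<in> F; x \<leadsto> y \<in> F; y \<in> carrier A\<rbrakk> \<Longrightarrow> y \<in> F"
  by (auto simp: hoop_filter_def)

lemma filter_upward: "\<lbrakk>hoop_filter F; x \<in> F; x \<preceq> y; y \<in> carrier A\<rbrakk> \<Longrightarrow> y \<in> F"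
  using filter_mp[of F x y] filter_one[of F] by simp

lemma filter_mult:
  assumes F: "hoop_filter F" and x: "x \<in> F" and y: "y \<in> F"
  shows "x \<otimes> y \<in> F"
proof -
  have xy: "x \<in> carrier A" "y \<in> carrier A" using filter_carrier F x y by blast+
  have "x \<preceq> y \<leadsto> (x \<otimes> y)" using residuation[of x y "x \<otimes> y"] xy by (simp add: imp_refl)
  then have "y \<leadsto> (x \<otimes> y) \<in> F" using filter_upward[OF F x] xy by (simp add: imp_closed)
  then show ?thesis using filter_mp[OF F y] xy by simp
qed

text \<open>The filter generated by \<open>F\<close> and \<open>a\<close>. Powers are needed because
  \<open>a\<close> need not be idempotent.\<close>

definition filter_insert :: "'a \<Rightarrow> 'a set \<Rightarrow> 'a set" where
  "filter_insert a F = {y \<in> carrier A. \<exists>k::nat. (a [^] k) \<leadsto> y \<in> F}"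

lemma filter_insert:
  assumes F: "hoop_filter F" and a: "a \<in> carrier A"
  shows "hoop_filter (filter_insert a F)" "F \<subseteq> filter_insert a F" "a \<in> filter_insert a F"
proof -
  have "z \<in> filter_insert a F"
    if y: "y \<in> filter_insert a F" and yz: "y \<leadsto> z \<in> filter_insert a F" and z: "z \<in> carrier A" for y z
  proof -
    obtain k l :: nat where k: "a [^] k \<leadsto> y \<in> F" and l: "a [^] l \<leadsto> (y \<leadsto> z) \<in> F"
      using y yz by (auto simp: filter_insert_def)
    let ?p = "a [^] k" and ?q = "a [^] l"
    have cl: "y \<in> carrier A" "?p \<in> carrier A" "?q \<in> carrier A"
      using y a by (auto simp: filter_insert_def)
    \<comment> \<open>The product of both memberships, used with exponent \<open>k + l\<close>:
      multiplied by both powers it lies below \<open>y \<otimes> (y \<leadsto> z)\<close>, hence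
      below \<open>z\<close>.\<close>
    let ?h = "(?p \<leadsto> y) \<otimes> (?q \<leadsto> (y \<leadsto> z))"
    have h: "?h \<in> F" using filter_mult[OF F k l] .
    have "((?p \<leadsto> y) \<otimes> ?p) \<otimes> ((?q \<leadsto> (y \<leadsto> z)) \<otimes> ?q) \<preceq> y \<otimes> (y \<leadsto> z)"
      using cl z by (intro mult_mono2_hle modus_ponens) (simp_all add: imp_closed)
    moreover have "y \<otimes> (y \<leadsto> z) \<preceq> z"
      using modus_ponens[of y z] cl z by (simp add: m_comm imp_closed)
    ultimately have "((?p \<leadsto> y) \<otimes> ?p) \<otimes> ((?q \<leadsto> (y \<leadsto> z)) \<otimes> ?q) \<preceq> z"
      by (rule hle_trans[rotated 3]) (use cl z in \<open>simp_all add: imp_closed\<close>)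
    moreover have "((?p \<leadsto> y) \<otimes> ?p) \<otimes> ((?q \<leadsto> (y \<leadsto> z)) \<otimes> ?q) = ?h \<otimes> (?p \<otimes> ?q)"
      using cl z by (simp add: m_ac imp_closed)
    ultimately have "?h \<preceq> (?p \<otimes> ?q) \<leadsto> z"
      using residuation[of ?h "?p \<otimes> ?q" z] cl z by (simp add: imp_closed)
    then have "(?p \<otimes> ?q) \<leadsto> z \<in> F" using filter_upward[OF F h] cl z by (simp add: imp_closed)
    then have "a [^] (k + l) \<leadsto> z \<in> F" using a by (simp add: nat_pow_mult)
    then show ?thesis using z by (auto simp: filter_insert_def)
  qed
  moreover have "\<one> \<in> filter_insert a F"
    using filter_one[OF F] by (auto simp: filter_insert_def imp_refl intro!: exI[of _ "0::nat"])
  moreover have "filter_insert a F \<subseteq> carrier A" by (auto simp: filter_insert_def)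
  ultimately show "hoop_filter (filter_insert a F)" unfolding hoop_filter_def by blast
  have "y \<in> filter_insert a F" if "y \<in> F" for y
  proof -
    have "a [^] (0::nat) \<leadsto> y \<in> F" using that filter_carrier[OF F] by (simp add: one_imp)
    then show ?thesis using that filter_carrier[OF F] unfolding filter_insert_def by blast
  qed
  then show "F \<subseteq> filter_insert a F" by blast
  have "a [^] (1::nat) \<leadsto> a \<in> F" using filter_one[OF F] a by (simp add: imp_refl)
  then show "a \<in> filter_insert a F" using a unfolding filter_insert_def by blast
qed

lemma exists_prime_filter:
  assumes u: "u \<in> carrier A" "u \<noteq> \<one>"
  shows "\<exists>F. hoop_filter F \<and> u \<notin> F \<and>
    (\<forall>x\<in>carrier A. \<forall>y\<in>carrier A. x \<leadsto> y \<in> F \<or> y \<leadsto> x \<in> F)"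
proof -
  let ?\<F> = "{F. hoop_filter F \<and> u \<notin> F}"
  have "{\<one>} \<in> ?\<F>" using u by (auto simp: hoop_filter_def one_imp)
  then have "?\<F> \<noteq> {}" by blast
  moreover have "\<Union>\<C> \<in> ?\<F>" if ne: "\<C> \<noteq> {}" and chain: "subset.chain ?\<F> \<C>" for \<C>
  proof -
    have sub: "\<C> \<subseteq> ?\<F>" using chain by (simp add: subset_chain_def)
    have "y \<in> \<Union>\<C>" if y: "y \<in> carrier A" and x: "x \<in> \<Union>\<C>" and xy: "x \<leadsto> y \<in> \<Union>\<C>" for x y
    proof -
      obtain F G where FG: "F \<in> \<C>" "x \<in> F" "G \<in> \<C>" "x \<leadsto> y \<in> G" using x xy by blast
      then have "F \<subseteq> G \<or> G \<subseteq> F" using chain by (auto simp: subset_chain_def)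
      then obtain H where "H \<in> \<C>" "x \<in> H" "x \<leadsto> y \<in> H" using FG by blast
      then show ?thesis using filter_mp[of H x y] sub y by blast
    qed
    moreover have "\<Union>\<C> \<subseteq> carrier A" using sub filter_carrier by blast
    moreover have "\<one> \<in> \<Union>\<C>" "u \<notin> \<Union>\<C>" using sub ne filter_one by blast+
    ultimately show ?thesis unfolding hoop_filter_def by blast
  qed
  ultimately obtain F where F: "F \<in> ?\<F>" and max: "\<And>G. \<lbrakk>G \<in> ?\<F>; F \<subseteq> G\<rbrakk> \<Longrightarrow> G = F"
    using subset_Zorn_nonempty[of ?\<F>] by blast
  have fil: "hoop_filter F" "u \<notin> F" using F by simp_all
  \<comment> \<open>By maximality, adjoining an element outside \<open>F\<close> yields a filter
    that contains \<open>u\<close>.\<close>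
  have power: "\<exists>k::nat. (a [^] k) \<leadsto> u \<in> F" if "a \<in> carrier A" "a \<notin> F" for a
  proof -
    have "u \<in> filter_insert a F" using max filter_insert[OF fil(1) that(1)] that(2) by blast
    then show ?thesis by (simp add: filter_insert_def)
  qed
  have "x \<leadsto> y \<in> F \<or> y \<leadsto> x \<in> F" if xy: "x \<in> carrier A" "y \<in> carrier A" for x y
  proof (rule ccontr)
    let ?a = "x \<leadsto> y" and ?b = "y \<leadsto> x"
    assume "\<not> (?a \<in> F \<or> ?b \<in> F)"
    then have ab: "?a \<in> carrier A" "?b \<in> carrier A" "?a \<notin> F" "?b \<notin> F"
      using xy by (simp_all add: imp_closed)
    obtain k l :: nat where kl: "?a [^] k \<leadsto> u \<in> F" "?b [^] l \<leadsto> u \<in> F"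
      using power[OF ab(1,3)] power[OF ab(2,4)] by blast
    let ?p = "?a [^] k" and ?q = "?b [^] l"
    have pq: "?p \<in> carrier A" "?q \<in> carrier A" using ab by simp_all
    let ?h = "(?p \<leadsto> u) \<otimes> (?q \<leadsto> u)"
    have hF: "?h \<in> F" using filter_mult[OF fil(1)] kl by blast
    then have h: "?h \<in> carrier A" using filter_carrier[OF fil(1)] by blast
    have "?h \<preceq> ?p \<leadsto> u" "?h \<preceq> ?q \<leadsto> u"
      using pq u by (simp_all add: mult_hle_left mult_hle_right imp_closed)
    then have le: "?p \<preceq> ?h \<leadsto> u" "?q \<preceq> ?h \<leadsto> u"
      using exchange[OF h pq(1) u(1)] exchange[OF h pq(2) u(1)] by simp_all
    \<comment> \<open>Prelinearity says that \<open>?a\<close> and \<open>?b\<close> join to 1.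
      Raising first one side and, after exchanging roles, the other to a power shows the same for
      \<open>?p\<close> and \<open>?q\<close>; both lie below \<open>?h \<leadsto> u\<close>, so
      \<open>?h\<close> is below \<open>u\<close>.\<close>
    have "?p \<leadsto> ?b = ?b" using pow_imp_eq[OF ab(1,2)] prelinearity[OF xy] by simp
    then have "?b \<leadsto> ?p = ?p" using imp_eq_sym[OF pq(1) ab(2)] by simp
    then have "?q \<leadsto> ?p = ?p" using pow_imp_eq[OF ab(2) pq(1)] by simp
    then have "(?q \<leadsto> ?p) \<leadsto> ?p = \<one>" using pq by (simp add: imp_refl)
    then have "\<one> \<preceq> ?h \<leadsto> u" using join_least[OF pq(2,1) _ le(2,1)] h u by (simp add: imp_closed)
    then have "?h \<preceq> u" using one_imp h u by (simp add: imp_closed)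
    then show False using filter_upward[OF fil(1) hF] u fil(2) by blast
  qed
  then show ?thesis using fil by blast
qed

section \<open>The congruence of a filter and its quotient\<close>

lemma imp_trans1:
  assumes "x \<in> carrier A" "y \<in> carrier A" "z \<in> carrier A"
  shows "y \<leadsto> z \<preceq> (x \<leadsto> y) \<leadsto> (x \<leadsto> z)"
  using imp_antimono_hle[of "(x \<leadsto> y) \<otimes> x" y z] modus_ponens[of x y] assms
    residuation[of "x \<leadsto> y" x z] by (simp add: imp_closed)

lemma imp_trans2:
  assumes "x \<in> carrier A" "y \<in> carrier A" "z \<in> carrier A"
  shows "x \<leadsto> y \<preceq> (y \<leadsto> z) \<leadsto> (x \<leadsto> z)"
  using imp_trans1[of x y z] exchange[of "y \<leadsto> z" "x \<leadsto> y" "x \<leadsto> z"] assms by (simp add: imp_closed)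

lemma imp_mult:
  assumes "x \<in> carrier A" "x' \<in> carrier A" "y \<in> carrier A"
  shows "x \<leadsto> x' \<preceq> (x \<otimes> y) \<leadsto> (x' \<otimes> y)"
proof -
  have "((x \<leadsto> x') \<otimes> x) \<otimes> y \<preceq> x' \<otimes> y"
    using assms by (intro mult_mono_hle modus_ponens) (simp_all add: imp_closed)
  then show ?thesis
    using residuation[of "x \<leadsto> x'" "x \<otimes> y" "x' \<otimes> y"] assms by (simp add: m_assoc imp_closed)
qed

lemma filter_imp_trans:
  assumes F: "hoop_filter F" and xyz: "x \<in> carrier A" "y \<in> carrier A" "z \<in> carrier A"
    and "x \<leadsto> y \<in> F" "y \<leadsto> z \<in> F"
  shows "x \<leadsto> z \<in> F"
proof -
  have "(y \<leadsto> z) \<leadsto> (x \<leadsto> z) \<in> F"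
    using filter_upward[OF F assms(5) imp_trans2[OF xyz]] xyz by (simp add: imp_closed)
  then show ?thesis using filter_mp[OF F assms(6)] xyz by (simp add: imp_closed)
qed

definition filter_class :: "'a set \<Rightarrow> 'a \<Rightarrow> 'a set" where
  "filter_class F x = {y \<in> carrier A. x \<leadsto> y \<in> F \<and> y \<leadsto> x \<in> F}"

lemma filter_class_eq_iff:
  assumes F: "hoop_filter F" and xy: "x \<in> carrier A" "y \<in> carrier A"
  shows "filter_class F x = filter_class F y \<longleftrightarrow> x \<leadsto> y \<in> F \<and> y \<leadsto> x \<in> F"
proof
  assume "filter_class F x = filter_class F y"
  moreover have "y \<in> filter_class F y" using xy F by (simp add: filter_class_def imp_refl filter_one)
  ultimately show "x \<leadsto> y \<in> F \<and> y \<leadsto> x \<in> F" by (auto simp: filter_class_def)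
next
  assume "x \<leadsto> y \<in> F \<and> y \<leadsto> x \<in> F"
  then show "filter_class F x = filter_class F y"
    using filter_imp_trans[OF F] xy unfolding filter_class_def by blast
qed

lemma filter_class_one_iff:
  assumes "hoop_filter F" "x \<in> carrier A"
  shows "filter_class F x = filter_class F \<one> \<longleftrightarrow> x \<in> F"
  using filter_class_eq_iff[of F x \<one>] assms by (simp add: imp_one one_imp filter_one)

end

context mv_algebra
begin

text \<open>One argument is replaced at a time, with transitivity in between. The inner claims give
  one implication for arbitrary arguments, and swapping the primed and unprimed ones gives the
  converse.\<close>

lemma mv_congruence_filter:
  assumes F: "hoop_filter F"
  shows "mv_congruence A (filter_class F)"
proof (unfold_locales, goal_cases)
  case (1 x x' y y')
  have "(x \<otimes> y) \<leadsto> (x' \<otimes> y') \<in> F"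
    if "x \<in> carrier A" "x' \<in> carrier A" "y \<in> carrier A" "y' \<in> carrier A"
      "x \<leadsto> x' \<in> F" "y \<leadsto> y' \<in> F" for x x' y y'
  proof -
    have "(x \<otimes> y) \<leadsto> (x' \<otimes> y) \<in> F"
      using filter_upward[OF F that(5) imp_mult[of x x' y]] that by (simp add: imp_closed)
    moreover have "(x' \<otimes> y) \<leadsto> (x' \<otimes> y') \<in> F"
      using filter_upward[OF F that(6) imp_mult[of y y' x']] that by (simp add: imp_closed m_comm)
    ultimately show ?thesis using filter_imp_trans[OF F, of _ "x' \<otimes> y"] that by simp
  qed
  then show ?case using 1 by (simp add: filter_class_eq_iff[OF F])
next
  case (2 x x' y y')
  have "(x \<leadsto> y) \<leadsto> (x' \<leadsto> y') \<in> F"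
    if "x \<in> carrier A" "x' \<in> carrier A" "y \<in> carrier A" "y' \<in> carrier A"
      "x' \<leadsto> x \<in> F" "y \<leadsto> y' \<in> F" for x x' y y'
  proof -
    have "(x \<leadsto> y) \<leadsto> (x' \<leadsto> y) \<in> F"
      using filter_upward[OF F that(5) imp_trans2[of x' x y]] that by (simp add: imp_closed)
    moreover have "(x' \<leadsto> y) \<leadsto> (x' \<leadsto> y') \<in> F"
      using filter_upward[OF F that(6) imp_trans1[of x' y y']] that by (simp add: imp_closed)
    ultimately show ?thesis
      using filter_imp_trans[OF F, of _ "x' \<leadsto> y"] that by (simp add: imp_closed)
  qed
  then show ?case using 2 by (simp add: filter_class_eq_iff[OF F] imp_closed)
qed

lemma quasi_holds_if_standard:
  assumes t: "vars t \<subseteq> {..<n}" and u: "vars u \<subseteq> {..<n}"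
    and std: "quasi_holds standard_hoop n t u"
  shows "quasi_holds A n t u"
proof (rule quasi_holdsI[OF t u], rule ccontr)
  fix e assume e: "\<And>i. i < n \<Longrightarrow> e i \<in> carrier A" and et: "eval A e t = \<one>"
    and eu: "eval A e u \<noteq> \<one>"
  have cl: "eval A e t \<in> carrier A" "eval A e u \<in> carrier A"
    using e t u by (auto intro!: eval_closed)
  obtain F where F: "hoop_filter F" "eval A e u \<notin> F"
    and prime: "\<And>x y. \<lbrakk>x \<in> carrier A; y \<in> carrier A\<rbrakk> \<Longrightarrow> x \<leadsto> y \<in> F \<or> y \<leadsto> x \<in> F"
    using exists_prime_filter[OF cl(2) eu] by blast
  interpret Q: mv_congruence A "filter_class F" using mv_congruence_filter[OF F(1)] .
  interpret B: mv_algebra Q.B by (rule Q.mv_algebra_image)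
  \<comment> \<open>\<open>\<zero>\<close> is below the value of \<open>u\<close>, so it is outside
    \<open>F\<close> as well and the quotient is nontrivial.\<close>
  have zero: "\<zero> \<notin> F" using filter_upward[OF F(1)] zero_least cl(2) F(2) by blast
  interpret B: mv_chain Q.B
  proof (unfold_locales, goal_cases)
    case (1 x y)
    then obtain a b where ab: "a \<in> carrier A" "b \<in> carrier A" "x = filter_class F a" "y = filter_class F b"
      by (auto simp: Q.image_simps)
    then show ?case
      using prime[of a b] by (simp add: Q.image_simps filter_class_one_iff[OF F(1)] imp_closed)
  next
    case 2
    then show ?case
      using zero by (simp add: Q.image_simps filter_class_one_iff[OF F(1)] zero_closed)
  qed
  have eval: "eval Q.B (\<lambda>i. filter_class F (e i)) s = filter_class F (eval A e s)"
    if "vars s \<subseteq> {..<n}" for s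
    using that e by (intro Q.eval_image) auto
  have "filter_class F (e i) \<in> carrier Q.B" if "i < n" for i
    using e that by (simp add: Q.image_simps)
  moreover have "eval Q.B (\<lambda>i. filter_class F (e i)) t = \<one>\<^bsub>Q.B\<^esub>"
    by (simp add: eval t et Q.image_simps)
  ultimately have "eval Q.B (\<lambda>i. filter_class F (e i)) u = \<one>\<^bsub>Q.B\<^esub>"
    by (rule quasi_holdsD[OF B.quasi_holds_chain[OF t u std] t u])
  then show False
    using F(2) cl by (simp add: eval u Q.image_simps filter_class_one_iff[OF F(1)])
qed

end

section \<open>Equivalence of the three conditions\<close>

lemma MV_valid_iff_standard:
  assumes t: "vars t \<subseteq> {..<n}" and u: "vars u \<subseteq> {..<n}" and inf: "infinite (UNIV :: 'a set)"
  shows "MV_valid TYPE('a) n t u \<longleftrightarrow> one_set n t \<subseteq> one_set n u"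
  unfolding one_set_subset_iff
  using MV_valid_imp_standard[OF t u inf] mv_algebra.quasi_holds_if_standard[OF _ t u]
  unfolding MV_valid_def by blast

theorem proposition6p1:
  fixes n :: nat and t u :: "nat wh_term"
  assumes "vars t \<subseteq> {..<n}" and "vars u \<subseteq> {..<n}"
    and "infinite (UNIV :: 'a set)" and "infinite (UNIV :: 'b set)"
  shows "(WH_valid TYPE('a) n t u \<longleftrightarrow> one_set n t \<subseteq> one_set n u) \<and>
         (one_set n t \<subseteq> one_set n u \<longleftrightarrow> MV_valid TYPE('b) n t u)"
  unfolding WH_valid_iff_MV_valid[OF assms(1,2)]
    MV_valid_iff_standard[OF assms(1-3)] MV_valid_iff_standard[OF assms(1,2,4)] by simp

end
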